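(* Let $\mathcal P$ be a cyclic proof, $\nu$ a node of $\mathcal P$, $\tau_{\mathcal A}\in\mathrm{TV}_{\mathcal A}(\nu)$ and $\tau_{\mathcal C}\in\mathrm{TV}_{\mathcal C}(\nu)$. Then for ${\sim}\in\{<,\le\}$: $\tau_{\mathcal C}\sim^{\nu}_{\mathcal P}\tau_{\mathcal A}$ if and only if $L_{\mathscr B^{(\mathcal P,\nu)}_{(\tau_{\mathcal A},\tau_{\mathcal C})}}\sim L_{\mathscr A^{(\mathcal P,\nu)}_{(\tau_{\mathcal A},\tau_{\mathcal C})}}$ and $\mathscr B^{(\mathcal P,\nu)}_{(\tau_{\mathcal A},\tau_{\mathcal C})}$ is grounded.
   Context: Abstract cyclic entailment systems. Fix sets $\mathcal{A}$ (antecedents) and $\mathcal{C}$ (consequents); a sequent is a pair $(A,C)$, written $A\vdash C$. A rule instance is a pair $(S,(S_1,\dots,S_n))$ of a sequent (conclusion) and finite sequence of sequents (premises); axiomatic if $n=0$. Rules are sets of rule instances indexed by a set $\mathbb R$ ($\mathcal R_r$ the rule of index $r$); the system uses a fixed $\vec r\subseteq\mathbb R$. A cyclic pre-proof $\mathcal P$ is a finite directed graph whose nodes have ordered children, each node $\nu$ labelled by a sequent $\mathrm{Seq}(\nu)$ and index $\mathrm{Rule}(\nu)\in\vec r$ with $(\mathrm{Seq}(\nu),(\mathrm{Seq}(\nu_1),\dots,\mathrm{Seq}(\nu_n)))\in\mathcal R_{\mathrm{Rule}(\nu)}$ for its children $\nu_1,\dots,\nu_n$; $\nu$ is identified with this rule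 instance (axiomatic iff no children). $\mathrm{Nodes}(\mathcal P)$ is its node set; $(\nu,\nu')\in\mathcal P$ means $\nu'$ is a child of $\nu$. A path is a finite or infinite sequence of nodes each a child of the previous; rooted at its first node. Semantics: a set $\mathcal M$ of models and relations $\models_{\mathcal A}$, $\models_{\mathcal C}$; $m$ falsifies $A\vdash C$ if $m\models_{\mathcal A}A$, $m\not\models_{\mathcal C}C$; valid means no falsifying model. Trace values: disjoint sets $\mathcal T_{\mathcal A},\mathcal T_{\mathcal C}$; maps $\mathrm{TV}_{\mathcal A},\mathrm{TV}_{\mathcal C}$ giving finite sets of trace values to antecedents (resp. consequents), extended to sequents and nodes; $\mathrm{TV}_{\mathcal A}(\mathcal P)=\bigcup_{\nu}\mathrm{TV}_{\mathcal A}(\nu)$, similarly $\mathrm{TV}_{\mathcal C}(\mathcal P)$. $\mathcal O$ is an initial segment of the ordinals. A computable trace pair function gives, for every non-axiomatic instance $(S,(S_1,\dots,S_n))\in\mathcal R_r$ and $1\le i\le n$, partial functions $\delta_1:\mathrm{TV}_{\mathcal A}(S)\times\mathrm{TV}_{\mathcal A}(S_i)\rightharpoonup\mathcal O$, $\delta_2:\mathrm{TV}_{\mathcal C}(S)\times\mathrm{TV}_{\mathcal C}(S_i)\rightharpoonup\mathcal O$, written $\delta_k^{(\nu,\nu')}$ for a node $\nu$ and its $i$-th child $\nu'$. Elements of $\mathrm{dom}(\delta_1^{(\nu,\nu')})$ (resp. $\mathrm{dom}(\delta_2^{(\nu,\nu')})$) are left-hand (resp. right-hand) trace pairs for $(\nu,\nu')$.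 A value $\tau$ is terminal for $(\nu,\nu')$ if no trace pair $(\tau,\tau')$ of the same side exists for $(\nu,\nu')$; terminal for $\nu$ if terminal for every child. A left-hand (resp. right-hand) trace is a finite or infinite sequence in $\mathcal T_{\mathcal A}$ (resp. $\mathcal T_{\mathcal C}$); it follows path $\vec\nu$ if for every $i$ with $\vec\tau_{i+1}$ existing, $\vec\nu_{i+1}$ exists and $(\vec\tau_i,\vec\tau_{i+1})$ is a trace pair of that side for $(\vec\nu_i,\vec\nu_{i+1})$. A cyclic proof is a cyclic pre-proof in which every infinite path has a tail followed by a left-hand trace whose pairs have value $>0$ at infinitely many positions. Ordinal trace function: a fixed partial function $\mathrm{Ord}:(\mathcal T_{\mathcal A}\cup\mathcal T_{\mathcal C})\times\mathcal M\rightharpoonup\mathcal O$, defined on every $(\tau,m)$ with $\tau\in\mathrm{TV}_{\mathcal A}(A)$, $m\models_{\mathcal A}A$ for some $A$, undefined on every $(\tau,m)$ with $\tau\in\mathrm{TV}_{\mathcal C}(C)$, $m\not\models_{\mathcal C}C$ for some $C$; $\underline 1$ is its least value. Standing assumption (descending counter-model property): for every $r\in\vec r$, instance $(S,(S_1,\dots,S_n))\in\mathcal R_r$ and model $m$ falsifying $S$, there are $i$ and $m'$ falsifying $S_i$ with $\mathrm{Ord}(\tau',m')+\alpha\le\mathrm{Ord}(\tau,m)$ whenever $\delta_1(\tau,\tau')=\alpha$ (premise $i$). Maximality, grounding, equating: a fixed exclusion predicate on pairs (rule instance $(A\vdash C,\vec S)$, $\tau\in\mathrm{TV}_{\mathcal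 C}(C)$), where the instance excludes $\tau$ only if no $m\models_{\mathcal A}A$ has $\mathrm{Ord}(\tau,m)$ defined. A right-hand trace $\vec\tau$ following $\vec\nu$ is maximal if finite, of length $n$, with $\vec\tau_n$ terminal for $\vec\nu_n$; positive if $\vec\nu_n$ does not exclude $\vec\tau_n$; partially maximal if $\vec\nu_n$ is axiomatic. For an instance $(A\vdash C,\vec S)$ and $\tau\in\mathrm{TV}_{\mathcal C}(C)$ terminal for it, $\tau$ is ground w.r.t. it if, whenever $A\vdash C$ is valid, every $m\models_{\mathcal A}A$ with $\mathrm{Ord}(\tau,m)$ defined has $\mathrm{Ord}(\tau,m)=\underline 1$; a trace $\vec\tau_{1..n}$ following $\vec\nu$ is grounded if $\vec\tau_n$ is ground w.r.t. $\vec\nu_n$. A sequent $S=A\vdash C$ equates $\tau\in\mathrm{TV}_{\mathcal A}(A)$, $\tau'\in\mathrm{TV}_{\mathcal C}(C)$ ($\tau=_S\tau'$) if, whenever $S$ is valid, every $m\models_{\mathcal A}A$ with $\mathrm{Ord}(\tau',m)$ defined has $\mathrm{Ord}(\tau,m)=\mathrm{Ord}(\tau',m)$. Size: for a finite left-hand (resp. right-hand) trace $\vec\tau_{1..n}$ following $\vec\nu$, $k=1$ (resp. $2$): $\mathrm{Prog}_{\vec\nu}(\vec\tau)=0$ if $n=1$, else $\delta_k^{(\vec\nu_{n-1},\vec\nu_n)}(\vec\tau_{n-1},\vec\tau_n)+\dots+\delta_k^{(\vec\nu_1,\vec\nu_2)}(\vec\tau_1,\vec\tau_2)$ (ordinal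 sum in this order). Trace value ordering: for a node $\nu$ of a cyclic proof $\mathcal P$, $\tau_1\in\mathrm{TV}_{\mathcal A}(\nu)$, $\tau_2\in\mathrm{TV}_{\mathcal C}(\nu)$: $\tau_2\le^{\nu}_{\mathcal P}\tau_1$ if for every positive maximal right-hand trace $\vec\tau_{1..n}$ with $\vec\tau_1=\tau_2$ following a path $\vec\nu$ rooted at $\nu$ there is a left-hand trace $\vec{\tau'}_{1..k}$, $k\le n$, $\vec{\tau'}_1=\tau_1$, following $\vec\nu$ with (i) $\mathrm{Prog}_{\vec\nu}(\vec\tau)\le\mathrm{Prog}_{\vec\nu}(\vec{\tau'})$ and (ii) either $\vec\tau$ is grounded, or $\vec\tau$ is partially maximal, $k=n$ and $\vec{\tau'}_n=_{\mathrm{Seq}(\vec\nu_n)}\vec\tau_n$. $\tau_2<^{\nu}_{\mathcal P}\tau_1$: same with strict inequality in (i). Weighted automata: over alphabet $\Sigma$ and semiring $(V,\oplus,\otimes)$, a tuple $(Q,q_I,F,\Delta,\gamma)$ with $\Delta\subseteq Q\times\Sigma\times Q$, $\gamma:\Delta\to V$. A run over $w=\sigma_1\dots\sigma_n$ is $q_0\sigma_1q_1\dots\sigma_nq_n$ with $q_0=q_I$ and $(q_{i-1},\sigma_i,q_i)\in\Delta$; accepting if $q_n\in F$; its value is $\gamma(q_0,\sigma_1,q_1)\otimes\dots\otimes\gamma(q_{n-1},\sigma_n,q_n)$ if accepting and $\bot$ otherwise. $L(w)=\bot$ if there is no run over $w$, else the $\oplus$ of the values of all runs over $w$. $L_1\le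 L_2$ iff $L_1(w)\le L_2(w)$ for all words $w$; $L_1<L_2$ iff $L_1(w)<L_2(w)$ for all $w$ with $L_1(w)\ne\bot$. The semiring used is $\mathcal O_\bot=\mathcal O\cup\{\bot\}$ with $\bot<\alpha$ for all $\alpha\in\mathcal O$, $\alpha\oplus\beta=\max(\alpha,\beta)$, $\alpha\otimes\beta=\beta+\alpha$ (ordinal addition), $\bot$ absorbing for $\otimes$. Construction: alphabet $\Sigma_{\mathcal P}=\mathrm{Nodes}(\mathcal P)\cup(\wp(\mathrm{TV}_{\mathcal A}(\mathcal P))\times\mathrm{TV}_{\mathcal C}(\mathcal P))$; for $\tau\in\mathrm{TV}_{\mathcal C}(\nu)$ let $T_\nu(\tau)=\{\tau'\in\mathrm{TV}_{\mathcal A}(\nu):\tau'=_{\mathrm{Seq}(\nu)}\tau\}$. For a node $\nu_0$, $\tau_1\in\mathrm{TV}_{\mathcal A}(\nu_0)$, $\tau_2\in\mathrm{TV}_{\mathcal C}(\nu_0)$: $\mathscr A^{(\mathcal P,\nu_0)}_{(\tau_1,\tau_2)}$ has states $(\mathrm{Nodes}(\mathcal P)\times\mathrm{TV}_{\mathcal A}(\mathcal P))\uplus\{\bot,\top,q_{\mathcal A}\}$, initial $q_{\mathcal A}$, all states except $q_{\mathcal A}$ final, and transitions: $(q_{\mathcal A},\nu_0,(\nu_0,\tau_1))$; $((\nu,\tau),\nu',(\nu',\tau'))$ for $(\nu,\nu')\in\mathcal P$ and $(\tau,\tau')\in\mathrm{dom}(\delta_1^{(\nu,\nu')})$; $((\nu,\tau),(T_\nu(\tau'),\tau'),\bot)$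 for $\nu$ axiomatic, $\tau'\in\mathrm{TV}_{\mathcal C}(\nu)$, $\tau\in T_\nu(\tau')$; $((\nu,\tau),\nu',\top)$ for $(\nu,\nu')\in\mathcal P$; $(\top,\nu,\top)$ for every node $\nu$. A transition from $(\nu,\tau)$ to $(\nu',\tau')$ has weight $\delta_1^{(\nu,\nu')}(\tau,\tau')$; all others have weight $0$. $\mathscr B^{(\mathcal P,\nu_0)}_{(\tau_1,\tau_2)}$ has states $(\mathrm{Nodes}(\mathcal P)\times\mathrm{TV}_{\mathcal C}(\mathcal P))\uplus\{\bot,q_{\mathcal C}\}$, initial $q_{\mathcal C}$; final states: $\bot$, all $(\nu,\tau)$ with $\nu$ not axiomatic, $\tau$ terminal for $\nu$ and not excluded by $\nu$, and all $(\nu,\tau)$ with $\nu$ axiomatic, $\tau$ ground w.r.t. $\nu$ and not excluded by $\nu$; transitions: $(q_{\mathcal C},\nu_0,(\nu_0,\tau_2))$; $((\nu,\tau),\nu',(\nu',\tau'))$ for $(\nu,\nu')\in\mathcal P$, $(\tau,\tau')\in\mathrm{dom}(\delta_2^{(\nu,\nu')})$; $((\nu,\tau),(T_\nu(\tau),\tau),\bot)$ for $\tau\in\mathrm{TV}_{\mathcal C}(\nu)$, $\nu$ axiomatic, $\tau$ not ground w.r.t. $\nu$ and not excluded by $\nu$. A transition from $(\nu,\tau)$ to $(\nu',\tau')$ has weight $\delta_2^{(\nu,\nu')}(\tau,\tau')$; all others $0$. $\mathscr B^{(\mathcal P,\nu_0)}_{(\tau_1,\tau_2)}$ is grounded if $\tau$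 is ground w.r.t. $\nu$ for every final state of the form $(\nu,\tau)$ reachable from the initial state. *)

theory Defs
  imports Main
begin

section \<open>Ordinals\<close>

text \<open>
  There is no type of all ordinals in HOL, so ordinals are taken from an arbitrary well-ordered
  type in which all ordinal sums exist, that is, a type order-isomorphic to an additively closed
  initial segment of the ordinals.  The three axioms say that \<open>a + b\<close> is the least upper bound of
  \<open>a\<close> and of the successors of all \<open>a + b'\<close> with \<open>b' < b\<close>; by induction on \<open>b\<close> this determines
  addition uniquely.
\<close>

class ordinal = wellorder + monoid_add +
  assumes ord_le_add: "a \<le> a + b"
    and ord_add_strict: "b' < b \<Longrightarrow> a + b' < a + b"
    and ord_add_least: "a \<le> c \<Longrightarrow> (\<And>b'. b' < b \<Longrightarrow> a + b' < c) \<Longrightarrow> a + b \<le> c"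

instance nat :: ordinal
proof
  fix a b c :: nat
  assume *: "a \<le> c" "\<And>b'. b' < b \<Longrightarrow> a + b' < c"
  show "a + b \<le> c"
    using *(1) *(2)[of "b - 1"] by (cases b) auto
qed auto

lemma ord_zero_le: "(0 :: 'o :: ordinal) \<le> a"
  using ord_le_add[of 0 a] by simp

lemma ord_add_left_mono: "(b :: 'o :: ordinal) \<le> c \<Longrightarrow> a + b \<le> a + c"
  using ord_add_strict[of b c a] by (cases "b = c") (auto simp: le_less)

lemma ord_add_right_mono:
  fixes a b c :: "'o :: ordinal"
  assumes "a \<le> b"
  shows "a + c \<le> b + c"
proof (induction c rule: less_induct)
  case (less c)
  show ?case
  proof (rule ord_add_least)
    show "a \<le> b + c" using assms ord_le_add[of b c] by order
    show "a + c' < b + c" if "c' < c" for c'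
      using less[OF that] ord_add_strict[OF that, of b] by order
  qed
qed


section \<open>The semiring of ordinals with bottom\<close>

datatype 'o weight = Bot | Wt 'o

instantiation weight :: (linorder) linorder
begin

fun less_eq_weight :: "'a weight \<Rightarrow> 'a weight \<Rightarrow> bool" where
  "less_eq_weight Bot y = True"
| "less_eq_weight (Wt a) Bot = False"
| "less_eq_weight (Wt a) (Wt b) = (a \<le> b)"

definition less_weight :: "'a weight \<Rightarrow> 'a weight \<Rightarrow> bool" where
  "less_weight x y = (x \<le> y \<and> \<not> y \<le> x)"

instance
proof
  fix x y z :: "'a weight"
  show "x < y \<longleftrightarrow> x \<le> y \<and> \<not> y \<le> x" by (rule less_weight_def)
  show "x \<le> x" by (cases x) auto
  show "x \<le> z" if "x \<le> y" "y \<le> z" using that by (cases x; cases y; cases z) auto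
  show "x = y" if "x \<le> y" "y \<le> x" using that by (cases x; cases y) auto
  show "x \<le> y \<or> y \<le> x" by (cases x; cases y) auto
qed

end

instantiation weight :: (ordinal) semiring_1
begin

definition zero_weight :: "'a weight" where "0 = Bot"

definition one_weight :: "'a weight" where "1 = Wt 0"

definition plus_weight :: "'a weight \<Rightarrow> 'a weight \<Rightarrow> 'a weight" where
  "plus_weight x y = max x y"

text \<open>The order of the factors is reversed by the multiplication.\<close>

fun times_weight :: "'a weight \<Rightarrow> 'a weight \<Rightarrow> 'a weight" where
  "times_weight (Wt a) (Wt b) = Wt (b + a)"
| "times_weight Bot y = Bot"
| "times_weight x Bot = Bot"

instance
proof
  fix x y z :: "'a weight"
  show "x + y + z = x + (y + z)" by (simp add: plus_weight_def max.assoc)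
  show "x + y = y + x" by (simp add: plus_weight_def max.commute)
  show "0 + x = x" by (cases x) (auto simp: plus_weight_def zero_weight_def max_def)
  show "x * y * z = x * (y * z)" by (cases x; cases y; cases z) (auto simp: add.assoc)
  show "1 * x = x" "x * 1 = x" by (cases x; simp add: one_weight_def)+
  show "0 * x = 0" "x * 0 = 0" by (cases x; simp add: zero_weight_def)+
  show "(0 :: 'a weight) \<noteq> 1" by (simp add: zero_weight_def one_weight_def)
  have max_Wt: "max (Wt a) (Wt b) = Wt (max a b)" for a b :: 'a
    by (simp add: max_def)
  have max_Bot: "max Bot x = x" "max x Bot = x" for x :: "'a weight"
    by (cases x; simp add: max_def)+
  have left: "c + max a b = max (c + a) (c + b)" for a b c :: 'a
    by (rule max_of_mono[symmetric]) (simp add: mono_def ord_add_left_mono)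
  have right: "max a b + c = max (a + c) (b + c)" for a b c :: 'a
    by (rule max_of_mono[symmetric, of "\<lambda>x. x + c"]) (simp add: mono_def ord_add_right_mono)
  show "(x + y) * z = x * z + y * z"
    by (cases x; cases y; cases z) (simp_all add: plus_weight_def max_Wt max_Bot left)
  show "x * (y + z) = x * y + x * z"
    by (cases x; cases y; cases z) (simp_all add: plus_weight_def max_Wt max_Bot right)
qed

end


section \<open>Weighted automata\<close>

record ('q, 's, 'v) wautomaton =
  wstates :: "'q set"
  winit :: 'q
  wfinal :: "'q set"
  wtrans :: "('q \<times> 's \<times> 'q) set"
  wweight :: "'q \<times> 's \<times> 'q \<Rightarrow> 'v"

text \<open>A run is given by its sequence of states; the letters are those of the word.\<close>

definition wruns :: "('q, 's, 'v) wautomaton \<Rightarrow> 's list \<Rightarrow> 'q list set" where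
  "wruns M w = {qs. length qs = Suc (length w) \<and> qs ! 0 = winit M \<and>
     (\<forall>i < length w. (qs ! i, w ! i, qs ! Suc i) \<in> wtrans M)}"

text \<open>The bottom value is the zero of the semiring.\<close>

definition wrun_value ::
    "('q, 's, 'v :: semiring_1) wautomaton \<Rightarrow> 's list \<Rightarrow> 'q list \<Rightarrow> 'v" where
  "wrun_value M w qs =
     (if last qs \<in> wfinal M
      then prod_list (map (\<lambda>i. wweight M (qs ! i, w ! i, qs ! Suc i)) [0..<length w])
      else 0)"

definition wlang :: "('q, 's, 'v :: semiring_1) wautomaton \<Rightarrow> 's list \<Rightarrow> 'v" where
  "wlang M w = (if wruns M w = {} then 0 else (\<Sum>qs\<in>wruns M w. wrun_value M w qs))"

definition wlang_le ::
    "'s set \<Rightarrow> ('s list \<Rightarrow> 'v :: {zero, ord}) \<Rightarrow> ('s list \<Rightarrow> 'v) \<Rightarrow> bool" where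
  "wlang_le \<Sigma> L1 L2 \<longleftrightarrow> (\<forall>w \<in> lists \<Sigma>. L1 w \<le> L2 w)"

definition wlang_less ::
    "'s set \<Rightarrow> ('s list \<Rightarrow> 'v :: {zero, ord}) \<Rightarrow> ('s list \<Rightarrow> 'v) \<Rightarrow> bool" where
  "wlang_less \<Sigma> L1 L2 \<longleftrightarrow> (\<forall>w \<in> lists \<Sigma>. L1 w \<noteq> 0 \<longrightarrow> L1 w < L2 w)"

definition wreachable :: "('q, 's, 'v) wautomaton \<Rightarrow> 'q \<Rightarrow> bool" where
  "wreachable M q \<longleftrightarrow> (winit M, q) \<in> {(p, p'). \<exists>a. (p, a, p') \<in> wtrans M}\<^sup>*"


section \<open>Finite or infinite sequences\<close>

datatype 'a sequence = FinSeq "'a list" | InfSeq "nat \<Rightarrow> 'a"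

text \<open>Positions are counted from 0.\<close>

fun has_pos :: "'a sequence \<Rightarrow> nat \<Rightarrow> bool" where
  "has_pos (FinSeq xs) i \<longleftrightarrow> i < length xs"
| "has_pos (InfSeq f) i \<longleftrightarrow> True"

fun seq_at :: "'a sequence \<Rightarrow> nat \<Rightarrow> 'a" where
  "seq_at (FinSeq xs) i = xs ! i"
| "seq_at (InfSeq f) i = f i"


section \<open>Entailment systems\<close>

type_synonym ('ant, 'con) sequent = "'ant \<times> 'con"

type_synonym ('ant, 'con) rule_instance =
  "('ant, 'con) sequent \<times> ('ant, 'con) sequent list"

text \<open>
  The trace pair functions \<open>\<delta>\<^sub>1\<close> and \<open>\<delta>\<^sub>2\<close> receive the index of the rule, the rule instance
  and the position (counted from 0) of the premise.  The disjoint union of the two sets of trace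
  values is a sum type.  The initial segment \<open>Ordinals\<close> need not be closed under addition; sums are
  formed in the ambient type.  Trace pair functions are not required to be computable.
\<close>

record ('ant, 'con, 'r, 'm, 'ta, 'tc, 'o) system =
  Rules :: "'r \<Rightarrow> ('ant, 'con) rule_instance set"
  Used :: "'r set"
  SatA :: "'m \<Rightarrow> 'ant \<Rightarrow> bool"
  SatC :: "'m \<Rightarrow> 'con \<Rightarrow> bool"
  TVA :: "'ant \<Rightarrow> 'ta set"
  TVC :: "'con \<Rightarrow> 'tc set"
  Ordinals :: "'o set"
  Delta1 :: "'r \<Rightarrow> ('ant, 'con) rule_instance \<Rightarrow> nat \<Rightarrow> ('ta \<times> 'ta) \<rightharpoonup> 'o"
  Delta2 :: "'r \<Rightarrow> ('ant, 'con) rule_instance \<Rightarrow> nat \<Rightarrow> ('tc \<times> 'tc) \<rightharpoonup> 'o"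
  Ord :: "(('ta + 'tc) \<times> 'm) \<rightharpoonup> 'o"
  Excludes :: "('ant, 'con) rule_instance \<Rightarrow> 'tc \<Rightarrow> bool"

definition falsifies ::
    "('ant, 'con, 'r, 'm, 'ta, 'tc, 'o) system \<Rightarrow> 'm \<Rightarrow> ('ant, 'con) sequent \<Rightarrow> bool" where
  "falsifies S m s \<longleftrightarrow> SatA S m (fst s) \<and> \<not> SatC S m (snd s)"

definition valid ::
    "('ant, 'con, 'r, 'm, 'ta, 'tc, 'o) system \<Rightarrow> ('ant, 'con) sequent \<Rightarrow> bool" where
  "valid S s \<longleftrightarrow> (\<nexists>m. falsifies S m s)"

definition descending_countermodel ::
    "('ant, 'con, 'r, 'm, 'ta, 'tc, 'o :: ordinal) system \<Rightarrow> bool" where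
  "descending_countermodel S \<longleftrightarrow>
     (\<forall>r \<in> Used S. \<forall>(s, ss) \<in> Rules S r. \<forall>m. falsifies S m s \<longrightarrow>
        (\<exists>i < length ss. \<exists>m'. falsifies S m' (ss ! i) \<and>
           (\<forall>\<tau> \<tau>' \<alpha>. Delta1 S r (s, ss) i (\<tau>, \<tau>') = Some \<alpha> \<longrightarrow>
              (\<exists>\<beta> \<beta>'. Ord S (Inl \<tau>, m) = Some \<beta> \<and> Ord S (Inl \<tau>', m') = Some \<beta>' \<and>
                 \<beta>' + \<alpha> \<le> \<beta>))))"

definition entailment_system ::
    "('ant, 'con, 'r, 'm, 'ta, 'tc, 'o :: ordinal) system \<Rightarrow> bool" where
  "entailment_system S \<longleftrightarrow>
     (\<forall>A. finite (TVA S A)) \<and>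
     (\<forall>C. finite (TVC S C)) \<and>
     (\<forall>\<alpha> \<in> Ordinals S. \<forall>\<beta> \<le> \<alpha>. \<beta> \<in> Ordinals S) \<and>
     (\<forall>r. \<forall>(s, ss) \<in> Rules S r. \<forall>i < length ss.
        dom (Delta1 S r (s, ss) i) \<subseteq> TVA S (fst s) \<times> TVA S (fst (ss ! i)) \<and>
        ran (Delta1 S r (s, ss) i) \<subseteq> Ordinals S \<and>
        dom (Delta2 S r (s, ss) i) \<subseteq> TVC S (snd s) \<times> TVC S (snd (ss ! i)) \<and>
        ran (Delta2 S r (s, ss) i) \<subseteq> Ordinals S) \<and>
     ran (Ord S) \<subseteq> Ordinals S \<and>
     (\<forall>\<tau> m A. \<tau> \<in> TVA S A \<and> SatA S m A \<longrightarrow> Ord S (Inl \<tau>, m) \<noteq> None) \<and>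
     (\<forall>\<tau> m C. \<tau> \<in> TVC S C \<and> \<not> SatC S m C \<longrightarrow> Ord S (Inr \<tau>, m) = None) \<and>
     descending_countermodel S \<and>
     (\<forall>A C ss. \<forall>\<tau> \<in> TVC S C. Excludes S ((A, C), ss) \<tau> \<longrightarrow>
        \<not> (\<exists>m. SatA S m A \<and> Ord S (Inr \<tau>, m) \<noteq> None))"

definition least_value :: "('ant, 'con, 'r, 'm, 'ta, 'tc, 'o :: ordinal) system \<Rightarrow> 'o" where
  "least_value S = (LEAST \<alpha>. \<alpha> \<in> ran (Ord S))"

definition equates ::
    "('ant, 'con, 'r, 'm, 'ta, 'tc, 'o) system \<Rightarrow> ('ant, 'con) sequent \<Rightarrow> 'ta \<Rightarrow> 'tc \<Rightarrow> bool" where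
  "equates S s \<tau> \<tau>' \<longleftrightarrow> \<tau> \<in> TVA S (fst s) \<and> \<tau>' \<in> TVC S (snd s) \<and>
     (valid S s \<longrightarrow>
       (\<forall>m. SatA S m (fst s) \<and> Ord S (Inr \<tau>', m) \<noteq> None \<longrightarrow>
          Ord S (Inl \<tau>, m) = Ord S (Inr \<tau>', m)))"


section \<open>Cyclic pre-proofs, traces and cyclic proofs\<close>

record ('n, 'ant, 'con, 'r) preproof =
  Nodes :: "'n set"
  Children :: "'n \<Rightarrow> 'n list"
  Seq :: "'n \<Rightarrow> ('ant, 'con) sequent"
  Rule :: "'n \<Rightarrow> 'r"

definition node_instance ::
    "('n, 'ant, 'con, 'r) preproof \<Rightarrow> 'n \<Rightarrow> ('ant, 'con) rule_instance" where
  "node_instance P \<nu> = (Seq P \<nu>, map (Seq P) (Children P \<nu>))"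

definition cyclic_preproof ::
    "('ant, 'con, 'r, 'm, 'ta, 'tc, 'o) system \<Rightarrow> ('n, 'ant, 'con, 'r) preproof \<Rightarrow> bool" where
  "cyclic_preproof S P \<longleftrightarrow> finite (Nodes P) \<and>
     (\<forall>\<nu> \<in> Nodes P. set (Children P \<nu>) \<subseteq> Nodes P \<and> Rule P \<nu> \<in> Used S \<and>
        node_instance P \<nu> \<in> Rules S (Rule P \<nu>))"

definition edge :: "('n, 'ant, 'con, 'r) preproof \<Rightarrow> 'n \<Rightarrow> 'n \<Rightarrow> bool" where
  "edge P \<nu> \<nu>' \<longleftrightarrow> \<nu> \<in> Nodes P \<and> \<nu>' \<in> set (Children P \<nu>)"

definition axiomatic :: "('n, 'ant, 'con, 'r) preproof \<Rightarrow> 'n \<Rightarrow> bool" where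
  "axiomatic P \<nu> \<longleftrightarrow> Children P \<nu> = []"

definition is_path :: "('n, 'ant, 'con, 'r) preproof \<Rightarrow> 'n sequence \<Rightarrow> bool" where
  "is_path P p \<longleftrightarrow>
     (\<forall>i. has_pos p i \<longrightarrow> seq_at p i \<in> Nodes P) \<and>
     (\<forall>i. has_pos p (Suc i) \<longrightarrow> edge P (seq_at p i) (seq_at p (Suc i)))"

definition rooted_at :: "'n sequence \<Rightarrow> 'n \<Rightarrow> bool" where
  "rooted_at p \<nu> \<longleftrightarrow> has_pos p 0 \<and> seq_at p 0 = \<nu>"

definition TVA_node ::
    "('ant, 'con, 'r, 'm, 'ta, 'tc, 'o) system \<Rightarrow> ('n, 'ant, 'con, 'r) preproof \<Rightarrow> 'n \<Rightarrow> 'ta set"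
  where "TVA_node S P \<nu> = TVA S (fst (Seq P \<nu>))"

definition TVC_node ::
    "('ant, 'con, 'r, 'm, 'ta, 'tc, 'o) system \<Rightarrow> ('n, 'ant, 'con, 'r) preproof \<Rightarrow> 'n \<Rightarrow> 'tc set"
  where "TVC_node S P \<nu> = TVC S (snd (Seq P \<nu>))"

definition TVA_proof ::
    "('ant, 'con, 'r, 'm, 'ta, 'tc, 'o) system \<Rightarrow> ('n, 'ant, 'con, 'r) preproof \<Rightarrow> 'ta set"
  where "TVA_proof S P = (\<Union>\<nu> \<in> Nodes P. TVA_node S P \<nu>)"

definition TVC_proof ::
    "('ant, 'con, 'r, 'm, 'ta, 'tc, 'o) system \<Rightarrow> ('n, 'ant, 'con, 'r) preproof \<Rightarrow> 'tc set"
  where "TVC_proof S P = (\<Union>\<nu> \<in> Nodes P. TVC_node S P \<nu>)"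

text \<open>
  An edge determines the position of the child.  Should a node be listed several times among the
  children of \<open>\<nu>\<close>, its first position is the one meant.
\<close>

definition child_pos :: "('n, 'ant, 'con, 'r) preproof \<Rightarrow> 'n \<Rightarrow> 'n \<Rightarrow> nat" where
  "child_pos P \<nu> \<nu>' = (LEAST i. i < length (Children P \<nu>) \<and> Children P \<nu> ! i = \<nu>')"

definition delta1 ::
    "('ant, 'con, 'r, 'm, 'ta, 'tc, 'o) system \<Rightarrow> ('n, 'ant, 'con, 'r) preproof \<Rightarrow>
     'n \<Rightarrow> 'n \<Rightarrow> ('ta \<times> 'ta) \<rightharpoonup> 'o" where
  "delta1 S P \<nu> \<nu>' = Delta1 S (Rule P \<nu>) (node_instance P \<nu>) (child_pos P \<nu> \<nu>')"

definition delta2 ::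
    "('ant, 'con, 'r, 'm, 'ta, 'tc, 'o) system \<Rightarrow> ('n, 'ant, 'con, 'r) preproof \<Rightarrow>
     'n \<Rightarrow> 'n \<Rightarrow> ('tc \<times> 'tc) \<rightharpoonup> 'o" where
  "delta2 S P \<nu> \<nu>' = Delta2 S (Rule P \<nu>) (node_instance P \<nu>) (child_pos P \<nu> \<nu>')"

text \<open>
  The following two notions serve both sides: with \<open>delta1 S P\<close> they are about left-hand traces,
  with \<open>delta2 S P\<close> about right-hand traces.
\<close>

definition follows ::
    "('n \<Rightarrow> 'n \<Rightarrow> ('t \<times> 't) \<rightharpoonup> 'o) \<Rightarrow> 't sequence \<Rightarrow> 'n sequence \<Rightarrow> bool" where
  "follows \<delta> t p \<longleftrightarrow>
     (\<forall>i. has_pos t (Suc i) \<longrightarrow> has_pos p (Suc i) \<and>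
        (seq_at t i, seq_at t (Suc i)) \<in> dom (\<delta> (seq_at p i) (seq_at p (Suc i))))"

definition prog ::
    "('n \<Rightarrow> 'n \<Rightarrow> ('t \<times> 't) \<rightharpoonup> 'o :: ordinal) \<Rightarrow> 'n sequence \<Rightarrow> 't list \<Rightarrow> 'o" where
  "prog \<delta> p ts =
     sum_list (rev (map (\<lambda>i. the (\<delta> (seq_at p i) (seq_at p (Suc i)) (ts ! i, ts ! Suc i)))
       [0..<length ts - 1]))"

definition cyclic_proof ::
    "('ant, 'con, 'r, 'm, 'ta, 'tc, 'o :: ordinal) system \<Rightarrow> ('n, 'ant, 'con, 'r) preproof \<Rightarrow> bool"
  where
  "cyclic_proof S P \<longleftrightarrow> cyclic_preproof S P \<and>
     (\<forall>p. is_path P (InfSeq p) \<longrightarrow>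
        (\<exists>k t. follows (delta1 S P) (InfSeq t) (InfSeq (\<lambda>i. p (k + i))) \<and>
           (\<exists>\<^sub>\<infinity>i. the (delta1 S P (p (k + i)) (p (k + Suc i)) (t i, t (Suc i))) > 0)))"

definition terminal ::
    "('ant, 'con, 'r, 'm, 'ta, 'tc, 'o) system \<Rightarrow> ('n, 'ant, 'con, 'r) preproof \<Rightarrow>
     'n \<Rightarrow> 'tc \<Rightarrow> bool" where
  "terminal S P \<nu> \<tau> \<longleftrightarrow> (\<forall>\<nu>'. edge P \<nu> \<nu>' \<longrightarrow> (\<nexists>\<tau>'. (\<tau>, \<tau>') \<in> dom (delta2 S P \<nu> \<nu>')))"

definition ground ::
    "('ant, 'con, 'r, 'm, 'ta, 'tc, 'o :: ordinal) system \<Rightarrow> ('n, 'ant, 'con, 'r) preproof \<Rightarrow>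
     'n \<Rightarrow> 'tc \<Rightarrow> bool" where
  "ground S P \<nu> \<tau> \<longleftrightarrow> \<tau> \<in> TVC_node S P \<nu> \<and> terminal S P \<nu> \<tau> \<and>
     (valid S (Seq P \<nu>) \<longrightarrow>
       (\<forall>m. SatA S m (fst (Seq P \<nu>)) \<and> Ord S (Inr \<tau>, m) \<noteq> None \<longrightarrow>
          Ord S (Inr \<tau>, m) = Some (least_value S)))"

text \<open>
  In the following four definitions \<open>ts\<close> is a finite non-empty right-hand trace following \<open>p\<close>, and
  \<open>seq_at p (length ts - 1)\<close> is the node at which it ends.
\<close>

definition maximal ::
    "('ant, 'con, 'r, 'm, 'ta, 'tc, 'o) system \<Rightarrow> ('n, 'ant, 'con, 'r) preproof \<Rightarrow>
     'n sequence \<Rightarrow> 'tc list \<Rightarrow> bool" where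
  "maximal S P p ts \<longleftrightarrow> terminal S P (seq_at p (length ts - 1)) (last ts)"

definition positive ::
    "('ant, 'con, 'r, 'm, 'ta, 'tc, 'o) system \<Rightarrow> ('n, 'ant, 'con, 'r) preproof \<Rightarrow>
     'n sequence \<Rightarrow> 'tc list \<Rightarrow> bool" where
  "positive S P p ts \<longleftrightarrow> \<not> Excludes S (node_instance P (seq_at p (length ts - 1))) (last ts)"

definition partially_maximal ::
    "('n, 'ant, 'con, 'r) preproof \<Rightarrow> 'n sequence \<Rightarrow> 'tc list \<Rightarrow> bool" where
  "partially_maximal P p ts \<longleftrightarrow> axiomatic P (seq_at p (length ts - 1))"

definition grounded_trace ::
    "('ant, 'con, 'r, 'm, 'ta, 'tc, 'o :: ordinal) system \<Rightarrow> ('n, 'ant, 'con, 'r) preproof \<Rightarrow>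
     'n sequence \<Rightarrow> 'tc list \<Rightarrow> bool" where
  "grounded_trace S P p ts \<longleftrightarrow> ground S P (seq_at p (length ts - 1)) (last ts)"


section \<open>The trace value ordering\<close>

definition tv_order ::
    "('o \<Rightarrow> 'o \<Rightarrow> bool) \<Rightarrow> ('ant, 'con, 'r, 'm, 'ta, 'tc, 'o :: ordinal) system \<Rightarrow>
     ('n, 'ant, 'con, 'r) preproof \<Rightarrow> 'n \<Rightarrow> 'tc \<Rightarrow> 'ta \<Rightarrow> bool" where
  "tv_order R S P \<nu> \<tau>2 \<tau>1 \<longleftrightarrow>
     (\<forall>p ts. is_path P p \<and> rooted_at p \<nu> \<and> ts \<noteq> [] \<and> hd ts = \<tau>2 \<and>
        follows (delta2 S P) (FinSeq ts) p \<and> maximal S P p ts \<and> positive S P p ts \<longrightarrow>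
        (\<exists>ts'. ts' \<noteq> [] \<and> length ts' \<le> length ts \<and> hd ts' = \<tau>1 \<and>
           follows (delta1 S P) (FinSeq ts') p \<and>
           R (prog (delta2 S P) p ts) (prog (delta1 S P) p ts') \<and>
           (grounded_trace S P p ts \<or>
            partially_maximal P p ts \<and> length ts' = length ts \<and>
            equates S (Seq P (seq_at p (length ts - 1))) (last ts') (last ts))))"

definition tv_le ::
    "('ant, 'con, 'r, 'm, 'ta, 'tc, 'o :: ordinal) system \<Rightarrow>
     ('n, 'ant, 'con, 'r) preproof \<Rightarrow> 'n \<Rightarrow> 'tc \<Rightarrow> 'ta \<Rightarrow> bool" where
  "tv_le = tv_order (\<le>)"

definition tv_less ::
    "('ant, 'con, 'r, 'm, 'ta, 'tc, 'o :: ordinal) system \<Rightarrow>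
     ('n, 'ant, 'con, 'r) preproof \<Rightarrow> 'n \<Rightarrow> 'tc \<Rightarrow> 'ta \<Rightarrow> bool" where
  "tv_less = tv_order (<)"


section \<open>The two automata\<close>

type_synonym ('n, 'ta, 'tc) letter = "'n + ('ta set \<times> 'tc)"

definition alphabet ::
    "('ant, 'con, 'r, 'm, 'ta, 'tc, 'o) system \<Rightarrow> ('n, 'ant, 'con, 'r) preproof \<Rightarrow>
     ('n, 'ta, 'tc) letter set" where
  "alphabet S P = Nodes P <+> (Pow (TVA_proof S P) \<times> TVC_proof S P)"

definition equated ::
    "('ant, 'con, 'r, 'm, 'ta, 'tc, 'o) system \<Rightarrow> ('n, 'ant, 'con, 'r) preproof \<Rightarrow>
     'n \<Rightarrow> 'tc \<Rightarrow> 'ta set" where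
  "equated S P \<nu> \<tau> = {\<tau>' \<in> TVA_node S P \<nu>. equates S (Seq P \<nu>) \<tau>' \<tau>}"

datatype ('n, 't) stateA = PairA 'n 't | BotA | TopA | InitA

datatype ('n, 't) stateC = PairC 'n 't | BotC | InitC

definition statesA ::
    "('ant, 'con, 'r, 'm, 'ta, 'tc, 'o) system \<Rightarrow> ('n, 'ant, 'con, 'r) preproof \<Rightarrow>
     ('n, 'ta) stateA set" where
  "statesA S P = {PairA \<nu> \<tau> | \<nu> \<tau>. \<nu> \<in> Nodes P \<and> \<tau> \<in> TVA_proof S P} \<union> {BotA, TopA, InitA}"

definition statesC ::
    "('ant, 'con, 'r, 'm, 'ta, 'tc, 'o) system \<Rightarrow> ('n, 'ant, 'con, 'r) preproof \<Rightarrow>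
     ('n, 'tc) stateC set" where
  "statesC S P = {PairC \<nu> \<tau> | \<nu> \<tau>. \<nu> \<in> Nodes P \<and> \<tau> \<in> TVC_proof S P} \<union> {BotC, InitC}"

text \<open>The weight \<open>1\<close> of the semiring is the ordinal 0.\<close>

definition automatonA ::
    "('ant, 'con, 'r, 'm, 'ta, 'tc, 'o :: ordinal) system \<Rightarrow> ('n, 'ant, 'con, 'r) preproof \<Rightarrow>
     'n \<Rightarrow> 'ta \<Rightarrow> 'tc \<Rightarrow> (('n, 'ta) stateA, ('n, 'ta, 'tc) letter, 'o weight) wautomaton" where
  "automatonA S P \<nu>0 \<tau>1 \<tau>2 = \<lparr>
     wstates = statesA S P,
     winit = InitA,
     wfinal = statesA S P - {InitA},
     wtrans =
       {(InitA, Inl \<nu>0, PairA \<nu>0 \<tau>1)} \<union>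
       {(PairA \<nu> \<tau>, Inl \<nu>', PairA \<nu>' \<tau>') | \<nu> \<tau> \<nu>' \<tau>'.
          edge P \<nu> \<nu>' \<and> (\<tau>, \<tau>') \<in> dom (delta1 S P \<nu> \<nu>')} \<union>
       {(PairA \<nu> \<tau>, Inr (equated S P \<nu> \<tau>', \<tau>'), BotA) | \<nu> \<tau> \<tau>'.
          \<nu> \<in> Nodes P \<and> axiomatic P \<nu> \<and> \<tau>' \<in> TVC_node S P \<nu> \<and> \<tau> \<in> equated S P \<nu> \<tau>'} \<union>
       {(PairA \<nu> \<tau>, Inl \<nu>', TopA) | \<nu> \<tau> \<nu>'. edge P \<nu> \<nu>' \<and> \<tau> \<in> TVA_proof S P} \<union>
       {(TopA, Inl \<nu>, TopA) | \<nu>. \<nu> \<in> Nodes P},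
     wweight = (\<lambda>(q, a, q'). case (q, q') of
         (PairA \<nu> \<tau>, PairA \<nu>' \<tau>') \<Rightarrow> Wt (the (delta1 S P \<nu> \<nu>' (\<tau>, \<tau>')))
       | _ \<Rightarrow> 1) \<rparr>"

definition automatonB ::
    "('ant, 'con, 'r, 'm, 'ta, 'tc, 'o :: ordinal) system \<Rightarrow> ('n, 'ant, 'con, 'r) preproof \<Rightarrow>
     'n \<Rightarrow> 'ta \<Rightarrow> 'tc \<Rightarrow> (('n, 'tc) stateC, ('n, 'ta, 'tc) letter, 'o weight) wautomaton" where
  "automatonB S P \<nu>0 \<tau>1 \<tau>2 = \<lparr>
     wstates = statesC S P,
     winit = InitC,
     wfinal =
       {BotC} \<union>
       {PairC \<nu> \<tau> | \<nu> \<tau>. PairC \<nu> \<tau> \<in> statesC S P \<and> \<not> axiomatic P \<nu> \<and>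
          terminal S P \<nu> \<tau> \<and> \<not> Excludes S (node_instance P \<nu>) \<tau>} \<union>
       {PairC \<nu> \<tau> | \<nu> \<tau>. PairC \<nu> \<tau> \<in> statesC S P \<and> axiomatic P \<nu> \<and>
          ground S P \<nu> \<tau> \<and> \<not> Excludes S (node_instance P \<nu>) \<tau>},
     wtrans =
       {(InitC, Inl \<nu>0, PairC \<nu>0 \<tau>2)} \<union>
       {(PairC \<nu> \<tau>, Inl \<nu>', PairC \<nu>' \<tau>') | \<nu> \<tau> \<nu>' \<tau>'.
          edge P \<nu> \<nu>' \<and> (\<tau>, \<tau>') \<in> dom (delta2 S P \<nu> \<nu>')} \<union>
       {(PairC \<nu> \<tau>, Inr (equated S P \<nu> \<tau>, \<tau>), BotC) | \<nu> \<tau>.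
          \<nu> \<in> Nodes P \<and> \<tau> \<in> TVC_node S P \<nu> \<and> axiomatic P \<nu> \<and>
          \<not> ground S P \<nu> \<tau> \<and> \<not> Excludes S (node_instance P \<nu>) \<tau>},
     wweight = (\<lambda>(q, a, q'). case (q, q') of
         (PairC \<nu> \<tau>, PairC \<nu>' \<tau>') \<Rightarrow> Wt (the (delta2 S P \<nu> \<nu>' (\<tau>, \<tau>')))
       | _ \<Rightarrow> 1) \<rparr>"

definition grounded_automaton ::
    "('ant, 'con, 'r, 'm, 'ta, 'tc, 'o :: ordinal) system \<Rightarrow> ('n, 'ant, 'con, 'r) preproof \<Rightarrow>
     (('n, 'tc) stateC, 's, 'v) wautomaton \<Rightarrow> bool" where
  "grounded_automaton S P M \<longleftrightarrow>
     (\<forall>\<nu> \<tau>. PairC \<nu> \<tau> \<in> wfinal M \<and> wreachable M (PairC \<nu> \<tau>) \<longrightarrow> ground S P \<nu> \<tau>)"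

end

theory Submission
  imports Defs
begin

text \<open>
  Since the semiring addition is \<open>max\<close> and every word has finitely many runs, comparing the two
  languages amounts to dominating every accepting run of the right-hand automaton by some accepting
  run of the left-hand one.  A word of nodes is a path, and a run over it is a trace along the path
  whose value is the size of the trace.  On the right, accepting runs over such words are positive
  maximal traces, which groundedness of the automaton makes grounded; on the left, they are traces
  along a prefix of the path, the rest being consumed in \<open>TopA\<close>.  A positive maximal
  trace that is not grounded and ends at an axiom is accepted only after a final letter
  \<open>(equated S P \<nu> \<tau>, \<tau>)\<close>, which forces the left-hand trace to have the same
  length and to end with a value equated with \<open>\<tau>\<close>.
\<close>


section \<open>Values of runs\<close>

text \<open>Runs grow at the right end of the word, one transition per induction step, and the new
  weight multiplies on the right. Later arguments use this relation in place of state lists with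
  indexed products.\<close>

inductive wreaches :: "('q, 's, 'v :: semiring_1) wautomaton \<Rightarrow> 's list \<Rightarrow> 'q \<Rightarrow> 'v \<Rightarrow> bool"
  for M where
  init: "wreaches M [] (winit M) 1"
| step: "wreaches M w p v \<Longrightarrow> (p, a, q) \<in> wtrans M \<Longrightarrow>
    wreaches M (w @ [a]) q (v * wweight M (p, a, q))"

definition waccepts :: "('q, 's, 'v :: semiring_1) wautomaton \<Rightarrow> 's list \<Rightarrow> 'v \<Rightarrow> bool" where
  "waccepts M w v \<longleftrightarrow> (\<exists>q \<in> wfinal M. wreaches M w q v)"

lemma wreaches_Nil_iff: "wreaches M [] q v \<longleftrightarrow> q = winit M \<and> v = 1"
  by (auto elim: wreaches.cases intro: wreaches.init)

lemma wreaches_snoc_iff: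
  "wreaches M (w @ [a]) q v \<longleftrightarrow>
     (\<exists>p u. wreaches M w p u \<and> (p, a, q) \<in> wtrans M \<and> v = u * wweight M (p, a, q))"
  by (subst wreaches.simps) auto

lemma wruns_Nil: "wruns M [] = {[winit M]}"
  by (auto simp: wruns_def length_Suc_conv)

lemma wruns_snoc:
  "wruns M (w @ [a]) = {qs @ [q] | qs q. qs \<in> wruns M w \<and> (last qs, a, q) \<in> wtrans M}"
    (is "?L = ?R")
proof (rule set_eqI)
  fix rs
  show "rs \<in> ?L \<longleftrightarrow> rs \<in> ?R"
  proof (cases rs rule: rev_cases)
    case Nil
    then show ?thesis by (auto simp: wruns_def)
  next
    case (snoc qs q)
    have "last qs = qs ! length w" if "length qs = Suc (length w)"
      using that by (subst last_conv_nth) auto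
    then show ?thesis
      by (auto simp: snoc wruns_def nth_append less_Suc_eq)
  qed
qed

text \<open>In HOL \<open>sum\<close> over an infinite set is 0, here \<open>Bot\<close>, so the
  value of a word is the maximum over its runs only if these are finite in number. Finite branching
  gives this by induction on the word.\<close>

lemma finite_wruns:
  assumes "\<And>p a. finite {q. (p, a, q) \<in> wtrans M}"
  shows "finite (wruns M w)"
proof (induction w rule: rev_induct)
  case Nil
  then show ?case by (simp add: wruns_Nil)
next
  case (snoc a w)
  have "wruns M (w @ [a]) =
      (\<Union>qs \<in> wruns M w. (\<lambda>q. qs @ [q]) ` {q. (last qs, a, q) \<in> wtrans M})"
    by (auto simp: wruns_snoc)
  then show ?case using snoc assms by simp
qed

lemma wreaches_iff_wruns:
  "wreaches M w q v \<longleftrightarrow> (\<exists>qs \<in> wruns M w. last qs = q \<and>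
     v = prod_list (map (\<lambda>i. wweight M (qs ! i, w ! i, qs ! Suc i)) [0..<length w]))"
proof (induction w arbitrary: q v rule: rev_induct)
  case Nil
  then show ?case by (auto simp: wreaches_Nil_iff wruns_Nil)
next
  case (snoc a w)
  define g where "g = (\<lambda>w qs.
    prod_list (map (\<lambda>i. wweight M (qs ! i, w ! i, qs ! Suc i)) [0..<length w]))"
  have g: "g (w @ [a]) (qs @ [r]) = g w qs * wweight M (last qs, a, r)"
    if "qs \<in> wruns M w" for qs r
  proof -
    have len: "length qs = Suc (length w)" using that by (simp add: wruns_def)
    then have "(qs @ [r]) ! length w = last qs" "(qs @ [r]) ! Suc (length w) = r"
      by (simp_all add: nth_append last_conv_nth flip: length_0_conv)
    \<comment> \<open>All state indices here are at most \<open>length w\<close> and all letter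
      indices below it, so the appended state and letter are not seen.\<close>
    moreover have "prod_list (map (\<lambda>i. wweight M ((qs @ [r]) ! i, (w @ [a]) ! i, (qs @ [r]) ! Suc i))
        [0..<length w]) = g w qs"
      unfolding g_def using len by (intro arg_cong[of _ _ prod_list]) (auto simp: nth_append)
    ultimately show ?thesis by (simp add: g_def)
  qed
  have "wreaches M (w @ [a]) q v \<longleftrightarrow>
      (\<exists>qs \<in> wruns M w. (last qs, a, q) \<in> wtrans M \<and> v = g w qs * wweight M (last qs, a, q))"
    by (auto simp: wreaches_snoc_iff snoc.IH g_def)
  also have "\<dots> \<longleftrightarrow>
      (\<exists>qs \<in> wruns M w. (last qs, a, q) \<in> wtrans M \<and> v = g (w @ [a]) (qs @ [q]))"
    using g by auto
  also have "\<dots> \<longleftrightarrow> (\<exists>rs \<in> wruns M (w @ [a]). last rs = q \<and> v = g (w @ [a]) rs)"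
    unfolding wruns_snoc by (simp add: Bex_def) (metis last_snoc)
  finally show ?case by (simp only: g_def)
qed

lemma wreachable_iff_wreaches: "wreachable M q \<longleftrightarrow> (\<exists>w v. wreaches M w q v)"
proof
  assume "wreachable M q"
  then have "(winit M, q) \<in> {(p, p'). \<exists>a. (p, a, p') \<in> wtrans M}\<^sup>*"
    by (simp add: wreachable_def)
  then show "\<exists>w v. wreaches M w q v"
    by (induction rule: rtrancl_induct) (blast intro: wreaches.intros)+
next
  assume "\<exists>w v. wreaches M w q v"
  then obtain w v where "wreaches M w q v" by blast
  then show "wreachable M q"
    unfolding wreachable_def
    by (induction rule: wreaches.induct) (auto intro: rtrancl_into_rtrancl)
qed

section \<open>Languages as maxima over accepting runs\<close>

lemma Bot_le [simp]: "(Bot :: 'o :: linorder weight) \<le> x"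
  by (cases x) auto

text \<open>Semiring addition is \<open>max\<close>: a finite sum bounds its terms and, unless it is
  \<open>Bot\<close>, the value of the empty sum, it is one of them
  (\<open>sum_weight_attained\<close>).\<close>

lemma sum_weight_upper:
  fixes f :: "'a \<Rightarrow> 'o :: ordinal weight"
  shows "finite X \<Longrightarrow> x \<in> X \<Longrightarrow> f x \<le> sum f X"
  by (induction X rule: finite_induct) (auto simp: plus_weight_def le_max_iff_disj)

lemma sum_weight_attained:
  fixes f :: "'a \<Rightarrow> 'o :: ordinal weight"
  shows "finite X \<Longrightarrow> sum f X \<noteq> Bot \<Longrightarrow> \<exists>x \<in> X. sum f X = f x"
proof (induction X rule: finite_induct)
  case (insert x X)
  then show ?case
    by (cases "sum f X \<le> f x") (auto simp: plus_weight_def max_def zero_weight_def)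
qed (simp add: zero_weight_def)

lemma waccepts_le_wlang:
  fixes M :: "('q, 's, 'o :: ordinal weight) wautomaton"
  assumes "finite (wruns M w)" "waccepts M w v"
  shows "v \<le> wlang M w"
proof -
  obtain qs where qs: "qs \<in> wruns M w" "v = wrun_value M w qs"
    using assms(2) by (auto simp: waccepts_def wreaches_iff_wruns wrun_value_def)
  show ?thesis
    using sum_weight_upper[OF assms(1) qs(1), of "wrun_value M w"] qs by (auto simp: wlang_def)
qed

lemma wlang_waccepts:
  fixes M :: "('q, 's, 'o :: ordinal weight) wautomaton"
  assumes "finite (wruns M w)" "wlang M w \<noteq> Bot"
  shows "waccepts M w (wlang M w)"
proof -
  have L: "wlang M w = sum (wrun_value M w) (wruns M w)"
    by (simp add: wlang_def)
  obtain qs where qs: "qs \<in> wruns M w" "wlang M w = wrun_value M w qs"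
    using sum_weight_attained[OF assms(1)] assms(2) unfolding L by metis
  then have "last qs \<in> wfinal M"
    using assms(2) by (auto simp: wrun_value_def zero_weight_def split: if_splits)
  then show ?thesis
    using qs by (auto simp: waccepts_def wreaches_iff_wruns wrun_value_def)
qed

text \<open>The relation \<open>R\<close> is a parameter so that \<open><\<close> and
  \<open>\<le>\<close> share one argument. Only values \<open>Wt a\<close> of \<open>B\<close>
  matter, since a word of value \<open>Bot\<close> imposes nothing in either comparison.\<close>

definition waccepts_dominated ::
    "('o \<Rightarrow> 'o \<Rightarrow> bool) \<Rightarrow> 's set \<Rightarrow> ('p, 's, 'o :: ordinal weight) wautomaton \<Rightarrow>
     ('q, 's, 'o weight) wautomaton \<Rightarrow> bool" where
  "waccepts_dominated R \<Sigma> B A \<longleftrightarrow>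
     (\<forall>w \<in> lists \<Sigma>. \<forall>a. waccepts B w (Wt a) \<longrightarrow> (\<exists>b. waccepts A w (Wt b) \<and> R a b))"

text \<open>The value of a word is its largest accepted value. What dominates the largest value of
  \<open>B\<close> dominates the smaller ones, and enlarging the dominating value of
  \<open>A\<close> to the maximum does no harm. The hypotheses on \<open>R\<close> express these two
  shifts and hold for both \<open><\<close> and \<open>\<le>\<close>.\<close>

lemma wlang_dominated_iff:
  fixes A :: "('q, 's, 'o :: ordinal weight) wautomaton"
    and B :: "('p, 's, 'o weight) wautomaton"
  assumes fin: "\<And>w. finite (wruns A w)" "\<And>w. finite (wruns B w)"
    and R: "\<And>a b c. a \<le> b \<Longrightarrow> R b c \<Longrightarrow> R a c" "\<And>a b c. R a b \<Longrightarrow> b \<le> c \<Longrightarrow> R a c"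
  shows "(\<forall>w \<in> lists \<Sigma>. \<forall>a. wlang B w = Wt a \<longrightarrow> (\<exists>b. wlang A w = Wt b \<and> R a b)) \<longleftrightarrow>
    waccepts_dominated R \<Sigma> B A" (is "?L \<longleftrightarrow> ?R")
proof
  assume L: ?L
  show ?R
    unfolding waccepts_dominated_def
  proof (intro ballI allI impI)
    fix w a assume w: "w \<in> lists \<Sigma>" and "waccepts B w (Wt a)"
    then have "Wt a \<le> wlang B w" using fin by (intro waccepts_le_wlang)
    then obtain a' where a': "wlang B w = Wt a'" "a \<le> a'" by (cases "wlang B w") auto
    then obtain b where "wlang A w = Wt b" "R a' b" using L w by blast
    then show "\<exists>b. waccepts A w (Wt b) \<and> R a b"
      using wlang_waccepts[OF fin(1), of w] R(1) a' by fastforce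
  qed
next
  assume D: ?R
  show ?L
  proof (intro ballI allI impI)
    fix w a assume w: "w \<in> lists \<Sigma>" and a: "wlang B w = Wt a"
    then have "waccepts B w (Wt a)" using wlang_waccepts[OF fin(2), of w] by simp
    then obtain b where b: "waccepts A w (Wt b)" "R a b"
      using D w unfolding waccepts_dominated_def by blast
    then have "Wt b \<le> wlang A w" using fin by (intro waccepts_le_wlang)
    then show "\<exists>b. wlang A w = Wt b \<and> R a b"
      using b R(2) by (cases "wlang A w") auto
  qed
qed

lemma wlang_le_iff:
  fixes A :: "('q, 's, 'o :: ordinal weight) wautomaton"
    and B :: "('p, 's, 'o weight) wautomaton"
  assumes "\<And>w. finite (wruns A w)" "\<And>w. finite (wruns B w)"
  shows "wlang_le \<Sigma> (wlang B) (wlang A) \<longleftrightarrow> waccepts_dominated (\<le>) \<Sigma> B A"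
proof -
  have "x \<le> y \<longleftrightarrow> (\<forall>a. x = Wt a \<longrightarrow> (\<exists>b. y = Wt b \<and> a \<le> b))" for x y :: "'o weight"
    by (cases x; cases y) auto
  then show ?thesis
    unfolding wlang_le_def by (subst wlang_dominated_iff[OF assms, symmetric]) auto
qed

lemma wlang_less_iff:
  fixes A :: "('q, 's, 'o :: ordinal weight) wautomaton"
    and B :: "('p, 's, 'o weight) wautomaton"
  assumes "\<And>w. finite (wruns A w)" "\<And>w. finite (wruns B w)"
  shows "wlang_less \<Sigma> (wlang B) (wlang A) \<longleftrightarrow> waccepts_dominated (<) \<Sigma> B A"
proof -
  \<comment> \<open>The guard \<open>x \<noteq> 0\<close> excludes exactly \<open>x = Bot\<close>;
    once \<open>x = Wt a\<close>, both sides fail for \<open>y = Bot\<close>.\<close>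
  have "(x \<noteq> 0 \<longrightarrow> x < y) \<longleftrightarrow> (\<forall>a. x = Wt a \<longrightarrow> (\<exists>b. y = Wt b \<and> a < b))"
    for x y :: "'o weight"
    by (cases x; cases y) (auto simp: zero_weight_def less_weight_def)
  then show ?thesis
    unfolding wlang_less_def by (subst wlang_dominated_iff[OF assms, symmetric]) auto
qed


section \<open>Traces along finite paths\<close>

text \<open>\<open>traced P \<delta> \<nu>0 \<tau>0 ns \<nu> \<tau> a\<close>: some trace of size \<open>a\<close> starts with \<open>\<tau>0\<close>, follows the whole path
  \<open>ns\<close> from \<open>\<nu>0\<close> to \<open>\<nu>\<close>, and ends with \<open>\<tau>\<close>.\<close>

inductive traced ::
    "('n, 'ant, 'con, 'r) preproof \<Rightarrow> ('n \<Rightarrow> 'n \<Rightarrow> ('t \<times> 't) \<rightharpoonup> 'o :: ordinal) \<Rightarrow> 'n \<Rightarrow> 't \<Rightarrow>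
     'n list \<Rightarrow> 'n \<Rightarrow> 't \<Rightarrow> 'o \<Rightarrow> bool"
  for P \<delta> \<nu>0 \<tau>0 where
  start: "traced P \<delta> \<nu>0 \<tau>0 [\<nu>0] \<nu>0 \<tau>0 0"
| extend: "traced P \<delta> \<nu>0 \<tau>0 ns \<nu> \<tau> a \<Longrightarrow> edge P \<nu> \<nu>' \<Longrightarrow> \<delta> \<nu> \<nu>' (\<tau>, \<tau>') = Some b \<Longrightarrow>
    traced P \<delta> \<nu>0 \<tau>0 (ns @ [\<nu>']) \<nu>' \<tau>' (b + a)"

lemma traced_last: "traced P \<delta> \<nu>0 \<tau>0 ns \<nu> \<tau> a \<Longrightarrow> ns \<noteq> [] \<and> last ns = \<nu>"
  by (induction rule: traced.induct) auto

lemma traced_snoc_iff: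
  "traced P \<delta> \<nu>0 \<tau>0 (ns @ [\<nu>']) \<nu>'' \<tau>' c \<longleftrightarrow>
     (ns = [] \<and> \<nu>' = \<nu>0 \<and> \<nu>'' = \<nu>0 \<and> \<tau>' = \<tau>0 \<and> c = 0) \<or>
     (\<nu>'' = \<nu>' \<and> (\<exists>\<nu> \<tau> a b. traced P \<delta> \<nu>0 \<tau>0 ns \<nu> \<tau> a \<and> edge P \<nu> \<nu>' \<and>
        \<delta> \<nu> \<nu>' (\<tau>, \<tau>') = Some b \<and> c = b + a))"
  by (subst traced.simps) auto

lemma is_path_snoc:
  assumes "is_path P (FinSeq ns)" "ns \<noteq> []" "edge P (last ns) \<nu>'" "\<nu>' \<in> Nodes P"
  shows "is_path P (FinSeq (ns @ [\<nu>']))"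
  using assms by (auto simp: is_path_def nth_append less_Suc_eq last_conv_nth)
    (metis diff_Suc_1' nat_neq_iff not_less_eq)

lemma traced_is_path:
  assumes P: "\<forall>\<nu> \<nu>'. edge P \<nu> \<nu>' \<longrightarrow> \<nu>' \<in> Nodes P" and "\<nu>0 \<in> Nodes P"
    and "traced P \<delta> \<nu>0 \<tau>0 ns \<nu> \<tau> a"
  shows "is_path P (FinSeq ns) \<and> rooted_at (FinSeq ns) \<nu>0"
  using assms(3)
proof (induction rule: traced.induct)
  case start
  then show ?case using assms by (simp add: is_path_def rooted_at_def)
next
  case (extend ns \<nu> \<tau> a \<nu>' \<tau>' b)
  then show ?case
    using traced_last[OF extend(1)] P
    by (auto simp: rooted_at_def nth_append intro!: is_path_snoc)
qed

lemma traced_end: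
  assumes "traced P \<delta> \<nu>0 \<tau>0 ns \<nu> \<tau> a" "\<tau>0 \<in> T \<nu>0"
    and "\<And>\<nu> \<nu>' \<tau> \<tau>'. edge P \<nu> \<nu>' \<Longrightarrow> (\<tau>, \<tau>') \<in> dom (\<delta> \<nu> \<nu>') \<Longrightarrow> \<tau>' \<in> T \<nu>'"
  shows "\<tau> \<in> T \<nu>"
  using assms(1)
proof cases
  case start
  then show ?thesis using assms(2) by simp
next
  case extend
  then show ?thesis using assms(3) by blast
qed

section \<open>From traces as lists of values to \<open>traced\<close> and back\<close>

lemma follows_snoc_iff:
  assumes "ts \<noteq> []"
  shows "follows \<delta> (FinSeq (ts @ [t])) p \<longleftrightarrow> follows \<delta> (FinSeq ts) p \<and> has_pos p (length ts) \<and>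
    (last ts, t) \<in> dom (\<delta> (seq_at p (length ts - 1)) (seq_at p (length ts)))"
    (is "?L \<longleftrightarrow> ?R")
proof -
  obtain us u where us: "ts = us @ [u]" using assms by (cases ts rule: rev_cases) auto
  have "?L \<longleftrightarrow> (\<forall>i. Suc i < Suc (length ts) \<longrightarrow> has_pos p (Suc i) \<and>
      ((ts @ [t]) ! i, (ts @ [t]) ! Suc i) \<in> dom (\<delta> (seq_at p i) (seq_at p (Suc i))))"
    by (simp add: follows_def)
  also have "\<dots> \<longleftrightarrow> ?R"
    by (auto simp: follows_def us nth_append less_Suc_eq)
  finally show ?thesis .
qed

text \<open>The list of steps is reversed in \<open>prog\<close>, so the newest pair contributes the
  leftmost summand, as in \<open>traced.extend\<close>.\<close>

lemma prog_snoc: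
  assumes "ts \<noteq> []"
  shows "prog \<delta> p (ts @ [t]) =
    the (\<delta> (seq_at p (length ts - 1)) (seq_at p (length ts)) (last ts, t)) + prog \<delta> p ts"
proof -
  obtain us u where us: "ts = us @ [u]" using assms by (cases ts rule: rev_cases) auto
  let ?d = "\<lambda>ts i. the (\<delta> (seq_at p i) (seq_at p (Suc i)) (ts ! i, ts ! Suc i))"
  have "sum_list (rev (map (?d (ts @ [t])) [0..<length us])) =
      sum_list (rev (map (?d ts) [0..<length us]))"
    by (intro arg_cong[of _ _ "\<lambda>xs. sum_list (rev xs)"]) (auto simp: us nth_append)
  moreover have "(ts @ [t]) ! length us = last ts" "(ts @ [t]) ! Suc (length us) = t"
    "length ts = Suc (length us)"
    by (simp_all add: us nth_append)
  ultimately show ?thesis by (simp add: prog_def)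
qed

lemma follows_imp_traced:
  assumes "is_path P p" "rooted_at p \<nu>0"
  shows "ts \<noteq> [] \<Longrightarrow> hd ts = \<tau>0 \<Longrightarrow> follows \<delta> (FinSeq ts) p \<Longrightarrow>
    has_pos p (length ts - 1) \<and>
    traced P \<delta> \<nu>0 \<tau>0 (map (seq_at p) [0..<length ts]) (seq_at p (length ts - 1)) (last ts)
      (prog \<delta> p ts)"
proof (induction ts rule: rev_induct)
  case (snoc t ts)
  show ?case
  proof (cases "ts = []")
    case True
    then show ?thesis
      using snoc assms by (auto simp: rooted_at_def prog_def intro: traced.start)
  next
    case False
    note f = follows_snoc_iff[OF False, THEN iffD1, OF snoc.prems(3)]
    have tr: "traced P \<delta> \<nu>0 \<tau>0 (map (seq_at p) [0..<length ts]) (seq_at p (length ts - 1))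
        (last ts) (prog \<delta> p ts)"
      using snoc False f by simp
    have "edge P (seq_at p (length ts - 1)) (seq_at p (length ts))"
      using assms(1) f False by (auto simp: is_path_def dest!: spec[of _ "length ts - 1"])
    then have "traced P \<delta> \<nu>0 \<tau>0 (map (seq_at p) [0..<length ts] @ [seq_at p (length ts)])
        (seq_at p (length ts)) t (prog \<delta> p (ts @ [t]))"
      unfolding prog_snoc[OF False] using f by (intro traced.extend[OF tr]) auto
    then show ?thesis using f by simp
  qed
qed simp

text \<open>The path \<open>p\<close> only has to begin with \<open>ns\<close>: in the ordering,
  paths may be infinite and a left-hand trace may cover just an initial segment.\<close>

lemma traced_imp_follows:
  assumes "traced P \<delta> \<nu>0 \<tau>0 ns \<nu> \<tau> a"
    and "\<And>i. i < length ns \<Longrightarrow> has_pos p i \<and> seq_at p i = ns ! i"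
  shows "\<exists>ts. ts \<noteq> [] \<and> length ts = length ns \<and> hd ts = \<tau>0 \<and> last ts = \<tau> \<and>
    follows \<delta> (FinSeq ts) p \<and> prog \<delta> p ts = a"
  using assms
proof (induction rule: traced.induct)
  case start
  show ?case by (rule exI[of _ "[\<tau>0]"]) (simp add: follows_def prog_def)
next
  case (extend ns \<nu> \<tau> a \<nu>' \<tau>' b)
  have "has_pos p i \<and> seq_at p i = ns ! i" if "i < length ns" for i
    using extend.prems[of i] that by (simp add: nth_append)
  then obtain ts where ts: "ts \<noteq> []" "length ts = length ns" "hd ts = \<tau>0" "last ts = \<tau>"
      "follows \<delta> (FinSeq ts) p" "prog \<delta> p ts = a"
    using extend.IH by blast
  have ns: "ns \<noteq> []" "last ns = \<nu>" using traced_last[OF extend(1)] by auto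
  have "seq_at p (length ns - 1) = \<nu>"
    using ns extend.prems[of "length ns - 1"] by (simp add: nth_append last_conv_nth)
  moreover have "has_pos p (length ns)" "seq_at p (length ns) = \<nu>'"
    using extend.prems[of "length ns"] by auto
  ultimately show ?case
    using ts extend.hyps
    by (intro exI[of _ "ts @ [\<tau>']"]) (auto simp: follows_snoc_iff prog_snoc)
qed

text \<open>The condition depends only on the nodes met by the right-hand trace, so an arbitrary
  path can be cut to a finite list \<open>ns\<close> of the same length as that trace. The left-hand
  trace then follows the prefix of \<open>ns\<close> whose length \<open>k\<close> is its
  own.\<close>

lemma tv_order_iff:
  assumes P: "\<forall>\<nu> \<nu>'. edge P \<nu> \<nu>' \<longrightarrow> \<nu>' \<in> Nodes P" and \<nu>0: "\<nu>0 \<in> Nodes P"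
  shows "tv_order R S P \<nu>0 \<tau>C \<tau>A \<longleftrightarrow>
    (\<forall>ns \<nu> \<tau> a. traced P (delta2 S P) \<nu>0 \<tau>C ns \<nu> \<tau> a \<and> terminal S P \<nu> \<tau> \<and>
        \<not> Excludes S (node_instance P \<nu>) \<tau> \<longrightarrow>
      (\<exists>k \<nu>' \<tau>' b. k \<le> length ns \<and> traced P (delta1 S P) \<nu>0 \<tau>A (take k ns) \<nu>' \<tau>' b \<and> R a b \<and>
        (ground S P \<nu> \<tau> \<or> axiomatic P \<nu> \<and> k = length ns \<and> equates S (Seq P \<nu>) \<tau>' \<tau>)))"
    (is "?L \<longleftrightarrow> ?R")
proof
  assume L: ?L
  show ?R
  proof (intro allI impI, elim conjE)
    fix ns \<nu> \<tau> a
    assume tr: "traced P (delta2 S P) \<nu>0 \<tau>C ns \<nu> \<tau> a" and t: "terminal S P \<nu> \<tau>"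
      and e: "\<not> Excludes S (node_instance P \<nu>) \<tau>"
    let ?p = "FinSeq ns"
    note path = traced_is_path[OF P \<nu>0 tr]
    have \<nu>: "seq_at ?p (length ns - 1) = \<nu>"
      using traced_last[OF tr] by (auto simp: last_conv_nth)
    obtain ts where ts: "ts \<noteq> []" "length ts = length ns" "hd ts = \<tau>C" "last ts = \<tau>"
        "follows (delta2 S P) (FinSeq ts) ?p" "prog (delta2 S P) ?p ts = a"
      using traced_imp_follows[OF tr, of ?p] by auto
    have "maximal S P ?p ts" "positive S P ?p ts"
      using t e ts \<nu> by (auto simp: maximal_def positive_def)
    then have "is_path P ?p \<and> rooted_at ?p \<nu>0 \<and> ts \<noteq> [] \<and> hd ts = \<tau>C \<and>
        follows (delta2 S P) (FinSeq ts) ?p \<and> maximal S P ?p ts \<and> positive S P ?p ts"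
      using path ts by blast
    from L[unfolded tv_order_def, THEN spec, THEN spec, THEN mp, OF this]
    obtain ts' where ts': "ts' \<noteq> []" "length ts' \<le> length ts" "hd ts' = \<tau>A"
        "follows (delta1 S P) (FinSeq ts') ?p" "R a (prog (delta1 S P) ?p ts')"
        "grounded_trace S P ?p ts \<or> partially_maximal P ?p ts \<and> length ts' = length ts \<and>
            equates S (Seq P (seq_at ?p (length ts - 1))) (last ts') (last ts)"
      using ts(6) by blast
    \<comment> \<open>\<open>ts'\<close> is no longer than \<open>ts\<close>, hence no longer than
      \<open>ns\<close>, so its nodes form a prefix of \<open>ns\<close>.\<close>
    have "map (seq_at ?p) [0..<length ts'] = take (length ts') ns"
      using ts'(2) ts(2) by (auto intro!: nth_equalityI)
    then have "traced P (delta1 S P) \<nu>0 \<tau>A (take (length ts') ns) (seq_at ?p (length ts' - 1))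
        (last ts') (prog (delta1 S P) ?p ts')"
      using follows_imp_traced[of P ?p \<nu>0 ts' \<tau>A "delta1 S P"] path ts' by auto
    then show "\<exists>k \<nu>' \<tau>' b. k \<le> length ns \<and>
        traced P (delta1 S P) \<nu>0 \<tau>A (take k ns) \<nu>' \<tau>' b \<and> R a b \<and>
        (ground S P \<nu> \<tau> \<or> axiomatic P \<nu> \<and> k = length ns \<and> equates S (Seq P \<nu>) \<tau>' \<tau>)"
      using ts' ts \<nu> unfolding grounded_trace_def partially_maximal_def by metis
  qed
next
  assume R: ?R
  show ?L
    unfolding tv_order_def
  proof (intro allI impI, elim conjE)
    fix p ts
    assume path: "is_path P p" "rooted_at p \<nu>0"
      and ts: "ts \<noteq> []" "hd ts = \<tau>C" "follows (delta2 S P) (FinSeq ts) p"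
      and mp: "maximal S P p ts" "positive S P p ts"
    let ?\<nu> = "seq_at p (length ts - 1)"
    let ?ns = "map (seq_at p) [0..<length ts]"
    have tr: "traced P (delta2 S P) \<nu>0 \<tau>C ?ns ?\<nu> (last ts) (prog (delta2 S P) p ts)"
      using follows_imp_traced[OF path ts] by blast
    obtain k \<nu>' \<tau>' b where k: "k \<le> length ?ns"
        "traced P (delta1 S P) \<nu>0 \<tau>A (take k ?ns) \<nu>' \<tau>' b" "R (prog (delta2 S P) p ts) b"
        "ground S P ?\<nu> (last ts) \<or>
          axiomatic P ?\<nu> \<and> k = length ?ns \<and> equates S (Seq P ?\<nu>) \<tau>' (last ts)"
      using R[rule_format, of ?ns ?\<nu> "last ts" "prog (delta2 S P) p ts"] tr mp
      unfolding maximal_def positive_def by blast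
    \<comment> \<open>Position 0 exists because \<open>p\<close> is rooted, all later ones because
      \<open>ts\<close> follows \<open>p\<close>.\<close>
    have pos: "has_pos p i" if "i < length ts" for i
    proof (cases i)
      case 0
      then show ?thesis using path by (simp add: rooted_at_def)
    next
      case (Suc j)
      then show ?thesis using ts that by (simp add: follows_def)
    qed
    obtain ts' where "ts' \<noteq> []" "length ts' = k" "hd ts' = \<tau>A" "last ts' = \<tau>'"
        "follows (delta1 S P) (FinSeq ts') p" "prog (delta1 S P) p ts' = b"
      using traced_imp_follows[OF k(2), of p] k(1) pos by auto
    then show "\<exists>ts'. ts' \<noteq> [] \<and> length ts' \<le> length ts \<and> hd ts' = \<tau>A \<and>
           follows (delta1 S P) (FinSeq ts') p \<and>
           R (prog (delta2 S P) p ts) (prog (delta1 S P) p ts') \<and>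
           (grounded_trace S P p ts \<or>
            partially_maximal P p ts \<and> length ts' = length ts \<and>
            equates S (Seq P (seq_at p (length ts - 1))) (last ts') (last ts))"
      using k unfolding grounded_trace_def partially_maximal_def
      by (intro exI[of _ ts']) auto
  qed
qed


section \<open>Runs of the two automata\<close>

text \<open>Here \<open>c\<close> stands for \<open>PairA\<close> or \<open>PairC\<close>. A pair
  state is entered only from the initial state, reading \<open>\<nu>0\<close> with weight 1, or from
  a pair state along a trace pair. A run ending in one has therefore traced the whole word, and its
  product is the size of that trace.\<close>

lemma wreaches_pair_iff_traced:
  fixes M :: "('q, 'n + 'l, 'o :: ordinal weight) wautomaton"
  assumes inj: "\<And>\<nu> \<tau> \<nu>' \<tau>'. c \<nu> \<tau> = c \<nu>' \<tau>' \<longleftrightarrow> \<nu> = \<nu>' \<and> \<tau> = \<tau>'"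
    and init: "\<And>\<nu> \<tau>. c \<nu> \<tau> \<noteq> winit M"
    and into_init: "\<And>p a. (p, a, winit M) \<notin> wtrans M"
    and trans: "\<And>p x \<nu>' \<tau>'. (p, x, c \<nu>' \<tau>') \<in> wtrans M \<longleftrightarrow>
      (p = winit M \<and> x = Inl \<nu>0 \<and> \<nu>' = \<nu>0 \<and> \<tau>' = \<tau>0) \<or>
      (\<exists>\<nu> \<tau>. p = c \<nu> \<tau> \<and> x = Inl \<nu>' \<and> edge P \<nu> \<nu>' \<and> (\<tau>, \<tau>') \<in> dom (\<delta> \<nu> \<nu>'))"
    and weight: "\<And>x. wweight M (winit M, x, c \<nu>0 \<tau>0) = 1"
      "\<And>\<nu> \<tau> x \<nu>' \<tau>'. wweight M (c \<nu> \<tau>, x, c \<nu>' \<tau>') = Wt (the (\<delta> \<nu> \<nu>' (\<tau>, \<tau>')))"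
  shows "wreaches M w (c \<nu> \<tau>) v \<longleftrightarrow>
    (\<exists>ns a. w = map Inl ns \<and> v = Wt a \<and> traced P \<delta> \<nu>0 \<tau>0 ns \<nu> \<tau> a)"
proof (induction w arbitrary: \<nu> \<tau> v rule: rev_induct)
  case Nil
  then show ?case using init traced_last by (fastforce simp: wreaches_Nil_iff)
next
  case (snoc x w)
  \<comment> \<open>No transition enters the initial state, so only the empty word leads to
    it.\<close>
  have at_init: "wreaches M w (winit M) u \<longleftrightarrow> w = [] \<and> u = 1" for u
    using into_init by (cases w rule: rev_cases) (auto simp: wreaches_Nil_iff wreaches_snoc_iff)
  have "wreaches M (w @ [x]) (c \<nu> \<tau>) v \<longleftrightarrow>
      (\<exists>u. wreaches M w (winit M) u \<and> x = Inl \<nu>0 \<and> \<nu> = \<nu>0 \<and> \<tau> = \<tau>0 \<and>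
         v = u * wweight M (winit M, x, c \<nu>0 \<tau>0)) \<or>
      (\<exists>\<mu> \<sigma> u. wreaches M w (c \<mu> \<sigma>) u \<and> x = Inl \<nu> \<and> edge P \<mu> \<nu> \<and> (\<sigma>, \<tau>) \<in> dom (\<delta> \<mu> \<nu>) \<and>
         v = u * wweight M (c \<mu> \<sigma>, x, c \<nu> \<tau>))"
    unfolding wreaches_snoc_iff trans by blast
  also have "\<dots> \<longleftrightarrow>
      (w = [] \<and> x = Inl \<nu>0 \<and> \<nu> = \<nu>0 \<and> \<tau> = \<tau>0 \<and> v = 1) \<or>
      (\<exists>\<mu> \<sigma> u. wreaches M w (c \<mu> \<sigma>) u \<and> x = Inl \<nu> \<and> edge P \<mu> \<nu> \<and> (\<sigma>, \<tau>) \<in> dom (\<delta> \<mu> \<nu>) \<and>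
         v = u * Wt (the (\<delta> \<mu> \<nu> (\<sigma>, \<tau>))))"
    by (simp add: at_init weight)
  \<comment> \<open>The reversed multiplication, \<open>Wt a * Wt b = Wt (b + a)\<close>, places the
    new weight on the left exactly as \<open>traced.extend\<close> does.\<close>
  also have "\<dots> \<longleftrightarrow> (w = [] \<and> x = Inl \<nu>0 \<and> \<nu> = \<nu>0 \<and> \<tau> = \<tau>0 \<and> v = Wt 0) \<or>
      (\<exists>\<mu> \<sigma> ns a b. w = map Inl ns \<and> traced P \<delta> \<nu>0 \<tau>0 ns \<mu> \<sigma> a \<and> x = Inl \<nu> \<and> edge P \<mu> \<nu> \<and>
         \<delta> \<mu> \<nu> (\<sigma>, \<tau>) = Some b \<and> v = Wt (b + a))"
    unfolding snoc.IH one_weight_def by (auto; fastforce)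
  also have "\<dots> \<longleftrightarrow> (\<exists>ms y a. w = map Inl ms \<and> x = Inl y \<and> v = Wt a \<and>
      traced P \<delta> \<nu>0 \<tau>0 (ms @ [y]) \<nu> \<tau> a)"
    unfolding traced_snoc_iff by (simp, blast)
  also have "\<dots> \<longleftrightarrow> (\<exists>ns a. w @ [x] = map Inl ns \<and> v = Wt a \<and> traced P \<delta> \<nu>0 \<tau>0 ns \<nu> \<tau> a)"
    by (smt (verit) append_eq_map_conv map_append list.simps(8,9) map_eq_Cons_conv Nil_is_map_conv)
  finally show ?case .
qed

lemma automatonA_PairA:
  "wreaches (automatonA S P \<nu>0 \<tau>1 \<tau>2) w (PairA \<nu> \<tau>) v \<longleftrightarrow>
    (\<exists>ns a. w = map Inl ns \<and> v = Wt a \<and> traced P (delta1 S P) \<nu>0 \<tau>1 ns \<nu> \<tau> a)"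
  by (rule wreaches_pair_iff_traced) (auto simp: automatonA_def)

lemma automatonB_PairC:
  "wreaches (automatonB S P \<nu>0 \<tau>1 \<tau>2) w (PairC \<nu> \<tau>) v \<longleftrightarrow>
    (\<exists>ns a. w = map Inl ns \<and> v = Wt a \<and> traced P (delta2 S P) \<nu>0 \<tau>2 ns \<nu> \<tau> a)"
  by (rule wreaches_pair_iff_traced) (auto simp: automatonB_def)

section \<open>Runs that leave the pair states\<close>

lemma map_Inl_snoc_neq_Inr: "w @ [Inr y] \<noteq> map Inl ns"
  by (auto simp: append_eq_map_conv)

text \<open>\<open>BotA\<close> is entered only from a pair state at an axiom, and with weight 1, so
  the trace before the last letter keeps its size.\<close>

lemma automatonA_BotA:
  "wreaches (automatonA S P \<nu>0 \<tau>1 \<tau>2) w BotA v \<longleftrightarrow>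
    (\<exists>ns \<nu> \<tau> \<tau>' a. w = map Inl ns @ [Inr (equated S P \<nu> \<tau>', \<tau>')] \<and> v = Wt a \<and>
      traced P (delta1 S P) \<nu>0 \<tau>1 ns \<nu> \<tau> a \<and> \<nu> \<in> Nodes P \<and> axiomatic P \<nu> \<and>
      \<tau>' \<in> TVC_node S P \<nu> \<and> \<tau> \<in> equated S P \<nu> \<tau>')"
proof (cases w rule: rev_cases)
  case Nil
  then show ?thesis by (simp add: wreaches_Nil_iff automatonA_def)
next
  case (snoc u x)
  have trans: "(p, x, BotA) \<in> wtrans (automatonA S P \<nu>0 \<tau>1 \<tau>2) \<longleftrightarrow>
      (\<exists>\<nu> \<tau> \<tau>'. p = PairA \<nu> \<tau> \<and> x = Inr (equated S P \<nu> \<tau>', \<tau>') \<and> \<nu> \<in> Nodes P \<and> axiomatic P \<nu> \<and>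
        \<tau>' \<in> TVC_node S P \<nu> \<and> \<tau> \<in> equated S P \<nu> \<tau>')" for p
    by (auto simp: automatonA_def)
  have weight: "wweight (automatonA S P \<nu>0 \<tau>1 \<tau>2) (PairA \<nu> \<tau>, x, BotA) = 1" for \<nu> \<tau>
    by (simp add: automatonA_def)
  have "wreaches (automatonA S P \<nu>0 \<tau>1 \<tau>2) w BotA v \<longleftrightarrow>
      (\<exists>\<nu> \<tau> \<tau>' v'. wreaches (automatonA S P \<nu>0 \<tau>1 \<tau>2) u (PairA \<nu> \<tau>) v' \<and>
        v = v' * wweight (automatonA S P \<nu>0 \<tau>1 \<tau>2) (PairA \<nu> \<tau>, x, BotA) \<and>
        x = Inr (equated S P \<nu> \<tau>', \<tau>') \<and> \<nu> \<in> Nodes P \<and> axiomatic P \<nu> \<and>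
        \<tau>' \<in> TVC_node S P \<nu> \<and> \<tau> \<in> equated S P \<nu> \<tau>')"
    unfolding snoc wreaches_snoc_iff trans by blast
  then show ?thesis
    unfolding weight mult_1_right automatonA_PairA snoc append1_eq_conv by blast
qed

lemma automatonB_BotC:
  "wreaches (automatonB S P \<nu>0 \<tau>1 \<tau>2) w BotC v \<longleftrightarrow>
    (\<exists>ns \<nu> \<tau> a. w = map Inl ns @ [Inr (equated S P \<nu> \<tau>, \<tau>)] \<and> v = Wt a \<and>
      traced P (delta2 S P) \<nu>0 \<tau>2 ns \<nu> \<tau> a \<and> \<nu> \<in> Nodes P \<and> axiomatic P \<nu> \<and>
      \<tau> \<in> TVC_node S P \<nu> \<and> \<not> ground S P \<nu> \<tau> \<and> \<not> Excludes S (node_instance P \<nu>) \<tau>)"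
proof (cases w rule: rev_cases)
  case Nil
  then show ?thesis by (simp add: wreaches_Nil_iff automatonB_def)
next
  case (snoc u x)
  have trans: "(p, x, BotC) \<in> wtrans (automatonB S P \<nu>0 \<tau>1 \<tau>2) \<longleftrightarrow>
      (\<exists>\<nu> \<tau>. p = PairC \<nu> \<tau> \<and> x = Inr (equated S P \<nu> \<tau>, \<tau>) \<and> \<nu> \<in> Nodes P \<and> axiomatic P \<nu> \<and>
        \<tau> \<in> TVC_node S P \<nu> \<and> \<not> ground S P \<nu> \<tau> \<and> \<not> Excludes S (node_instance P \<nu>) \<tau>)" for p
    by (auto simp: automatonB_def)
  have weight: "wweight (automatonB S P \<nu>0 \<tau>1 \<tau>2) (PairC \<nu> \<tau>, x, BotC) = 1" for \<nu> \<tau>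
    by (simp add: automatonB_def)
  have "wreaches (automatonB S P \<nu>0 \<tau>1 \<tau>2) w BotC v \<longleftrightarrow>
      (\<exists>\<nu> \<tau> v'. wreaches (automatonB S P \<nu>0 \<tau>1 \<tau>2) u (PairC \<nu> \<tau>) v' \<and>
        v = v' * wweight (automatonB S P \<nu>0 \<tau>1 \<tau>2) (PairC \<nu> \<tau>, x, BotC) \<and>
        x = Inr (equated S P \<nu> \<tau>, \<tau>) \<and> \<nu> \<in> Nodes P \<and> axiomatic P \<nu> \<and>
        \<tau> \<in> TVC_node S P \<nu> \<and> \<not> ground S P \<nu> \<tau> \<and> \<not> Excludes S (node_instance P \<nu>) \<tau>)"
    unfolding snoc wreaches_snoc_iff trans by blast
  then show ?thesis
    unfolding weight mult_1_right automatonB_PairC snoc append1_eq_conv by blast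
qed

text \<open>\<open>k\<close> counts the letters read before \<open>TopA\<close> is entered. The
  entering letter makes \<open>k < length ns\<close> strict, and from that letter on all weights are
  1.\<close>

lemma automatonA_TopA_D:
  assumes "wreaches (automatonA S P \<nu>0 \<tau>1 \<tau>2) w TopA v"
  shows "\<exists>ns k \<nu> \<tau> a. w = map Inl ns \<and> k < length ns \<and> v = Wt a \<and>
    traced P (delta1 S P) \<nu>0 \<tau>1 (take k ns) \<nu> \<tau> a"
  using assms
proof (induction w arbitrary: v rule: rev_induct)
  case Nil
  then show ?case by (simp add: wreaches_Nil_iff automatonA_def)
next
  case (snoc x w)
  let ?A = "automatonA S P \<nu>0 \<tau>1 \<tau>2"
  obtain p u where pu: "wreaches ?A w p u" "(p, x, TopA) \<in> wtrans ?A"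
      "v = u * wweight ?A (p, x, TopA)"
    using snoc.prems by (auto simp: wreaches_snoc_iff)
  have "wweight ?A (p, x, TopA) = 1" by (cases p) (auto simp: automatonA_def)
  then have v: "v = u" using pu by simp
  obtain \<nu>' where x: "x = Inl \<nu>'" "p = TopA \<or> (\<exists>\<nu> \<tau>. p = PairA \<nu> \<tau>)"
    using pu(2) by (auto simp: automatonA_def)
  from x(2) show ?case
  proof (elim disjE exE)
    assume "p = TopA"
    then obtain ns k \<nu> \<tau> a where "w = map Inl ns" "k < length ns" "v = Wt a"
        "traced P (delta1 S P) \<nu>0 \<tau>1 (take k ns) \<nu> \<tau> a"
      using snoc.IH pu v by blast
    \<comment> \<open>Looping in \<open>TopA\<close> lengthens the word and keeps
      \<open>k\<close>.\<close>
    then show ?thesis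
      using x by (intro exI[of _ "ns @ [\<nu>']"] exI[of _ k]) auto
  next
    fix \<nu> \<tau> assume "p = PairA \<nu> \<tau>"
    then obtain ns a where "w = map Inl ns" "v = Wt a" "traced P (delta1 S P) \<nu>0 \<tau>1 ns \<nu> \<tau> a"
      using pu v by (auto simp: automatonA_PairA)
    \<comment> \<open>\<open>TopA\<close> is entered by this very letter, so tracing ended after all
      of \<open>ns\<close>.\<close>
    then show ?thesis
      using x by (intro exI[of _ "ns @ [\<nu>']"] exI[of _ "length ns"]) auto
  qed
qed

text \<open>Only the letter \<open>\<nu>'\<close> that enters \<open>TopA\<close> has to be a child
  of \<open>\<nu>\<close>; the loop afterwards reads arbitrary nodes \<open>ms\<close>.\<close>

lemma automatonA_TopA_I:
  assumes "traced P (delta1 S P) \<nu>0 \<tau>1 ns \<nu> \<tau> a" "\<tau> \<in> TVA_proof S P" "edge P \<nu> \<nu>'"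
  shows "set ms \<subseteq> Nodes P \<Longrightarrow>
    wreaches (automatonA S P \<nu>0 \<tau>1 \<tau>2) (map Inl (ns @ \<nu>' # ms)) TopA (Wt a)"
proof (induction ms rule: rev_induct)
  case Nil
  let ?A = "automatonA S P \<nu>0 \<tau>1 \<tau>2"
  have "wreaches ?A (map Inl ns) (PairA \<nu> \<tau>) (Wt a)"
    using assms by (auto simp: automatonA_PairA)
  then have "wreaches ?A (map Inl ns @ [Inl \<nu>']) TopA
      (Wt a * wweight ?A (PairA \<nu> \<tau>, Inl \<nu>', TopA))"
    by (rule wreaches.step) (use assms in \<open>auto simp: automatonA_def\<close>)
  then show ?case by (simp add: automatonA_def)
next
  case (snoc \<mu> ms)
  let ?A = "automatonA S P \<nu>0 \<tau>1 \<tau>2"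
  have "wreaches ?A (map Inl (ns @ \<nu>' # ms)) TopA (Wt a)"
    using snoc by simp
  then have "wreaches ?A (map Inl (ns @ \<nu>' # ms) @ [Inl \<mu>]) TopA
      (Wt a * wweight ?A (TopA, Inl \<mu>, TopA))"
    by (rule wreaches.step) (use snoc in \<open>auto simp: automatonA_def\<close>)
  then show ?case by (simp add: automatonA_def)
qed

section \<open>Acceptance by the two automata\<close>

lemma automatonA_accepts_path_D:
  assumes "waccepts (automatonA S P \<nu>0 \<tau>1 \<tau>2) (map Inl ns) (Wt b)"
  shows "\<exists>k \<le> length ns. \<exists>\<nu> \<tau>. traced P (delta1 S P) \<nu>0 \<tau>1 (take k ns) \<nu> \<tau> b"
proof -
  let ?A = "automatonA S P \<nu>0 \<tau>1 \<tau>2"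
  obtain q where q: "q \<in> wfinal ?A" "wreaches ?A (map Inl ns) q (Wt b)"
    using assms by (auto simp: waccepts_def)
  show ?thesis
  proof (cases q)
    case (PairA \<nu> \<tau>)
    then have "traced P (delta1 S P) \<nu>0 \<tau>1 (take (length ns) ns) \<nu> \<tau> b"
      using q by (auto simp: automatonA_PairA inj_map_eq_map)
    then show ?thesis by blast
  next
    case BotA
    then show ?thesis using q by (auto simp: automatonA_BotA map_Inl_snoc_neq_Inr[symmetric])
  next
    case TopA
    from automatonA_TopA_D[OF q(2)[unfolded this]]
    have "\<exists>k < length ns. \<exists>\<nu> \<tau>. traced P (delta1 S P) \<nu>0 \<tau>1 (take k ns) \<nu> \<tau> b"
      by (auto simp: inj_map_eq_map)
    then show ?thesis by (blast intro: less_imp_le)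
  next
    case InitA
    then show ?thesis using q by (simp add: automatonA_def)
  qed
qed

text \<open>If the trace ends early, the rest is read in \<open>TopA\<close>, which can be entered
  because the next letter of a path is a child of the node reached. Otherwise the run ends in a pair
  state, which is itself final.\<close>

lemma automatonA_accepts_path_I:
  assumes tr: "traced P (delta1 S P) \<nu>0 \<tau>1 (take k ns) \<nu> \<tau> b"
    and path: "is_path P (FinSeq ns)" and \<tau>: "\<tau> \<in> TVA_proof S P"
  shows "waccepts (automatonA S P \<nu>0 \<tau>1 \<tau>2) (map Inl ns) (Wt b)"
proof (cases "k < length ns")
  case True
  let ?A = "automatonA S P \<nu>0 \<tau>1 \<tau>2"
  \<comment> \<open>A traced list of nodes is non-empty, so \<open>k - 1\<close> is a genuine
    position, the one of \<open>\<nu>\<close>.\<close>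
  have k: "k > 0" "last (take k ns) = \<nu>"
    using traced_last[OF tr] by auto
  have "last (take k ns) = ns ! (k - 1)"
    using True k(1) by (subst last_conv_nth) auto
  then have "ns ! (k - 1) = \<nu>" using k(2) by simp
  then have e: "edge P \<nu> (ns ! k)"
    using path True k(1) by (auto simp: is_path_def dest!: spec[of _ "k - 1"])
  have "set ns \<subseteq> Nodes P" using path by (auto simp: is_path_def in_set_conv_nth)
  then have "set (drop (Suc k) ns) \<subseteq> Nodes P" using set_drop_subset by fast
  then have "wreaches ?A (map Inl (take k ns @ ns ! k # drop (Suc k) ns)) TopA (Wt b)"
    by (rule automatonA_TopA_I[OF tr \<tau> e])
  moreover have "TopA \<in> wfinal ?A" by (simp add: automatonA_def statesA_def)
  ultimately show ?thesis
    unfolding waccepts_def id_take_nth_drop[OF True, symmetric] by blast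
next
  case False
  let ?A = "automatonA S P \<nu>0 \<tau>1 \<tau>2"
  have tr: "traced P (delta1 S P) \<nu>0 \<tau>1 ns \<nu> \<tau> b" using tr False by simp
  have "\<nu> \<in> Nodes P"
    using traced_last[OF tr] path by (auto simp: is_path_def last_conv_nth)
  then have "PairA \<nu> \<tau> \<in> wfinal ?A"
    using \<tau> by (simp add: automatonA_def statesA_def)
  moreover have "wreaches ?A (map Inl ns) (PairA \<nu> \<tau>) (Wt b)"
    using tr by (auto simp: automatonA_PairA)
  ultimately show ?thesis unfolding waccepts_def by blast
qed

text \<open>Pair states and \<open>TopA\<close> are reached by words of nodes alone, so a last
  letter \<open>Inr (T, \<tau>')\<close> can be accepted only in \<open>BotA\<close>. This keeps the
  left-hand trace from stopping before the end of \<open>ns\<close>.\<close>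

lemma automatonA_accepts_equated_iff:
  "waccepts (automatonA S P \<nu>0 \<tau>1 \<tau>2) (map Inl ns @ [Inr (T, \<tau>')]) (Wt b) \<longleftrightarrow>
    (\<exists>\<nu> \<tau>. T = equated S P \<nu> \<tau>' \<and> traced P (delta1 S P) \<nu>0 \<tau>1 ns \<nu> \<tau> b \<and> \<nu> \<in> Nodes P \<and>
      axiomatic P \<nu> \<and> \<tau>' \<in> TVC_node S P \<nu> \<and> \<tau> \<in> equated S P \<nu> \<tau>')"
    (is "?L \<longleftrightarrow> ?R")
proof -
  let ?A = "automatonA S P \<nu>0 \<tau>1 \<tau>2"
  let ?w = "map Inl ns @ [Inr (T, \<tau>')]"
  have "q = BotA" if "q \<in> wfinal ?A" "wreaches ?A ?w q (Wt b)" for q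
  proof (cases q)
    case (PairA \<nu> \<tau>)
    then show ?thesis using that map_Inl_snoc_neq_Inr by (fastforce simp: automatonA_PairA)
  next
    case TopA
    then show ?thesis using that automatonA_TopA_D map_Inl_snoc_neq_Inr by fastforce
  next
    case InitA
    then show ?thesis using that by (simp add: automatonA_def)
  qed simp
  moreover have "BotA \<in> wfinal ?A" by (simp add: automatonA_def statesA_def)
  ultimately have "?L \<longleftrightarrow> wreaches ?A ?w BotA (Wt b)"
    unfolding waccepts_def by blast
  also have "\<dots> \<longleftrightarrow> ?R"
    unfolding automatonA_BotA by (auto simp: inj_map_eq_map)
  finally show ?thesis .
qed

text \<open>The two families of final pair states combine because \<open>ground\<close> includes
  \<open>terminal\<close>.\<close>

lemma automatonB_final_PairC:
  "PairC \<nu> \<tau> \<in> wfinal (automatonB S P \<nu>0 \<tau>1 \<tau>2) \<longleftrightarrow>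
    \<nu> \<in> Nodes P \<and> \<tau> \<in> TVC_proof S P \<and> terminal S P \<nu> \<tau> \<and>
    \<not> Excludes S (node_instance P \<nu>) \<tau> \<and> (axiomatic P \<nu> \<longrightarrow> ground S P \<nu> \<tau>)"
  by (auto simp: automatonB_def statesC_def ground_def)

lemma axiomatic_imp_terminal: "axiomatic P \<nu> \<Longrightarrow> terminal S P \<nu> \<tau>"
  by (simp add: axiomatic_def terminal_def edge_def)

section \<open>Finiteness of the sets of runs\<close>

lemma finite_wruns_automatonA:
  assumes "finite (Nodes P)" "finite (TVA_proof S P)" "\<nu>0 \<in> Nodes P" "\<tau>1 \<in> TVA_proof S P"
    and "\<And>\<nu> \<nu>'. edge P \<nu> \<nu>' \<Longrightarrow> \<nu>' \<in> Nodes P"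
    and "\<And>\<nu> \<nu>' \<tau> \<tau>' b. edge P \<nu> \<nu>' \<Longrightarrow> delta1 S P \<nu> \<nu>' (\<tau>, \<tau>') = Some b \<Longrightarrow> \<tau>' \<in> TVA_proof S P"
  shows "finite (wruns (automatonA S P \<nu>0 \<tau>1 \<tau>2) w)"
proof (rule finite_wruns)
  fix p a
  have "{PairA \<nu> \<tau> | \<nu> \<tau>. \<nu> \<in> Nodes P \<and> \<tau> \<in> TVA_proof S P} =
      (\<lambda>(\<nu>, \<tau>). PairA \<nu> \<tau>) ` (Nodes P \<times> TVA_proof S P)" by auto
  then have "finite (statesA S P)"
    using assms by (simp add: statesA_def)
  \<comment> \<open>The relation \<open>wtrans\<close> is not restricted to \<open>statesA\<close>
    by definition; its targets lie there because edges lead to nodes and trace pairs to trace values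
    of the proof.\<close>
  moreover have "{q. (p, a, q) \<in> wtrans (automatonA S P \<nu>0 \<tau>1 \<tau>2)} \<subseteq> statesA S P"
    using assms(3-6) by (auto simp: automatonA_def statesA_def)
  ultimately show "finite {q. (p, a, q) \<in> wtrans (automatonA S P \<nu>0 \<tau>1 \<tau>2)}"
    by (rule rev_finite_subset)
qed

lemma finite_wruns_automatonB:
  assumes "finite (Nodes P)" "finite (TVC_proof S P)" "\<nu>0 \<in> Nodes P" "\<tau>2 \<in> TVC_proof S P"
    and "\<And>\<nu> \<nu>'. edge P \<nu> \<nu>' \<Longrightarrow> \<nu>' \<in> Nodes P"
    and "\<And>\<nu> \<nu>' \<tau> \<tau>' b. edge P \<nu> \<nu>' \<Longrightarrow> delta2 S P \<nu> \<nu>' (\<tau>, \<tau>') = Some b \<Longrightarrow> \<tau>' \<in> TVC_proof S P"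
  shows "finite (wruns (automatonB S P \<nu>0 \<tau>1 \<tau>2) w)"
proof (rule finite_wruns)
  fix p a
  have "{PairC \<nu> \<tau> | \<nu> \<tau>. \<nu> \<in> Nodes P \<and> \<tau> \<in> TVC_proof S P} =
      (\<lambda>(\<nu>, \<tau>). PairC \<nu> \<tau>) ` (Nodes P \<times> TVC_proof S P)" by auto
  then have "finite (statesC S P)"
    using assms by (simp add: statesC_def)
  moreover have "{q. (p, a, q) \<in> wtrans (automatonB S P \<nu>0 \<tau>1 \<tau>2)} \<subseteq> statesC S P"
    using assms(3-6) by (auto simp: automatonB_def statesC_def)
  ultimately show "finite {q. (p, a, q) \<in> wtrans (automatonB S P \<nu>0 \<tau>1 \<tau>2)}"
    by (rule rev_finite_subset)
qed


section \<open>Trace value ordering and language inclusion\<close>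

lemma cyclic_preproof_edge:
  assumes "cyclic_preproof S P" "edge P \<nu> \<nu>'"
  shows "\<nu>' \<in> Nodes P"
  using assms by (auto simp: cyclic_preproof_def edge_def)

lemma
  assumes S: "entailment_system S" and P: "cyclic_preproof S P" and e: "edge P \<nu> \<nu>'"
  shows delta1_target: "(\<tau>, \<tau>') \<in> dom (delta1 S P \<nu> \<nu>') \<Longrightarrow> \<tau>' \<in> TVA_node S P \<nu>'"
    and delta2_target: "(\<sigma>, \<sigma>') \<in> dom (delta2 S P \<nu> \<nu>') \<Longrightarrow> \<sigma>' \<in> TVC_node S P \<nu>'"
proof -
  let ?i = "child_pos P \<nu> \<nu>'"
  let ?ss = "map (Seq P) (Children P \<nu>)"
  \<comment> \<open>The edge supplies some position of \<open>\<nu>'\<close> among the children, so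
    the \<open>LEAST\<close> in \<open>child_pos\<close> denotes such a position.\<close>
  obtain i where "i < length (Children P \<nu>) \<and> Children P \<nu> ! i = \<nu>'"
    using e by (auto simp: edge_def in_set_conv_nth)
  then have i: "?i < length (Children P \<nu>)" "Children P \<nu> ! ?i = \<nu>'"
    unfolding child_pos_def by (metis (mono_tags, lifting) LeastI)+
  have "(Seq P \<nu>, ?ss) \<in> Rules S (Rule P \<nu>)"
    using P e by (auto simp: cyclic_preproof_def edge_def node_instance_def)
  then have
    "dom (Delta1 S (Rule P \<nu>) (Seq P \<nu>, ?ss) ?i) \<subseteq> TVA S (fst (Seq P \<nu>)) \<times> TVA S (fst (?ss ! ?i))"
    "dom (Delta2 S (Rule P \<nu>) (Seq P \<nu>, ?ss) ?i) \<subseteq> TVC S (snd (Seq P \<nu>)) \<times> TVC S (snd (?ss ! ?i))"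
    using S i(1) unfolding entailment_system_def by fastforce+
  then show "(\<tau>, \<tau>') \<in> dom (delta1 S P \<nu> \<nu>') \<Longrightarrow> \<tau>' \<in> TVA_node S P \<nu>'"
    and "(\<sigma>, \<sigma>') \<in> dom (delta2 S P \<nu> \<nu>') \<Longrightarrow> \<sigma>' \<in> TVC_node S P \<nu>'"
    using i unfolding delta1_def delta2_def node_instance_def TVA_node_def TVC_node_def by auto
qed

text \<open>Traces and accepting runs correspond with equal values, so the comparison carries over
  whatever relation \<open>R\<close> is.\<close>

lemma tv_order_iff_waccepts_dominated:
  fixes S :: "('ant, 'con, 'r, 'm, 'ta, 'tc, 'o :: ordinal) system"
    and P :: "('n, 'ant, 'con, 'r) preproof"
  assumes S: "entailment_system S" and P: "cyclic_preproof S P" and \<nu>0: "\<nu>0 \<in> Nodes P"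
    and \<tau>A: "\<tau>A \<in> TVA_node S P \<nu>0" and \<tau>C: "\<tau>C \<in> TVC_node S P \<nu>0"
  defines "A \<equiv> automatonA S P \<nu>0 \<tau>A \<tau>C" and "B \<equiv> automatonB S P \<nu>0 \<tau>A \<tau>C"
  shows "tv_order R S P \<nu>0 \<tau>C \<tau>A \<longleftrightarrow>
    waccepts_dominated R (alphabet S P) B A \<and> grounded_automaton S P B"
proof -
  have edge: "\<forall>\<nu> \<nu>'. edge P \<nu> \<nu>' \<longrightarrow> \<nu>' \<in> Nodes P"
    using cyclic_preproof_edge[OF P] by blast
  have endA: "\<tau> \<in> TVA_node S P \<nu>" if "traced P (delta1 S P) \<nu>0 \<tau>A ns \<nu> \<tau> a" for ns \<nu> \<tau> a
    by (rule traced_end[where T = "TVA_node S P", OF that \<tau>A]) (rule delta1_target[OF S P])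
  have endC: "\<tau> \<in> TVC_node S P \<nu>" if "traced P (delta2 S P) \<nu>0 \<tau>C ns \<nu> \<tau> a" for ns \<nu> \<tau> a
    by (rule traced_end[where T = "TVC_node S P", OF that \<tau>C]) (rule delta2_target[OF S P])
  have nodes: "is_path P (FinSeq ns)" "set ns \<subseteq> Nodes P" "\<nu> \<in> Nodes P" "last ns = \<nu>" "ns \<noteq> []"
    if "traced P \<delta> \<nu>0 \<tau>0 ns \<nu> \<tau> a"
    for \<delta> :: "'n \<Rightarrow> 'n \<Rightarrow> ('t \<times> 't) \<rightharpoonup> 'o" and \<tau>0 ns \<nu> \<tau> a
  proof -
    show p: "is_path P (FinSeq ns)" using traced_is_path[OF edge \<nu>0 that] by blast
    then show n: "set ns \<subseteq> Nodes P" by (auto simp: is_path_def in_set_conv_nth)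
    show l: "last ns = \<nu>" "ns \<noteq> []" using traced_last[OF that] by auto
    then show "\<nu> \<in> Nodes P" using n last_in_set by blast
  qed
  have proofA: "\<tau> \<in> TVA_proof S P" if "\<tau> \<in> TVA_node S P \<nu>" "\<nu> \<in> Nodes P" for \<tau> \<nu>
    using that by (auto simp: TVA_proof_def)
  have proofC: "\<tau> \<in> TVC_proof S P" if "\<tau> \<in> TVC_node S P \<nu>" "\<nu> \<in> Nodes P" for \<tau> \<nu>
    using that by (auto simp: TVC_proof_def)
  have wordn: "map Inl ns \<in> lists (alphabet S P)" if "set ns \<subseteq> Nodes P" for ns
    using that by (auto simp: alphabet_def)
  note iff = tv_order_iff[OF edge \<nu>0, of R S \<tau>C \<tau>A]
  show ?thesis
  proof
    assume T: "tv_order R S P \<nu>0 \<tau>C \<tau>A"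
    note T = T[unfolded iff, rule_format, OF conjI, OF _ conjI]
    have "waccepts_dominated R (alphabet S P) B A"
      unfolding waccepts_dominated_def
    proof (intro ballI allI impI)
      fix w a assume "waccepts B w (Wt a)"
      then obtain q where q: "q \<in> wfinal B" "wreaches B w q (Wt a)"
        by (auto simp: waccepts_def)
      show "\<exists>b. waccepts A w (Wt b) \<and> R a b"
      proof (cases q)
        case (PairC \<nu> \<tau>)
        then obtain ns where ns: "w = map Inl ns" "traced P (delta2 S P) \<nu>0 \<tau>C ns \<nu> \<tau> a"
          using q by (auto simp: B_def automatonB_PairC)
        have "terminal S P \<nu> \<tau>" "\<not> Excludes S (node_instance P \<nu>) \<tau>"
          using q(1) by (auto simp: PairC B_def automatonB_final_PairC)
        then obtain k \<nu>' \<tau>' b where k: "traced P (delta1 S P) \<nu>0 \<tau>A (take k ns) \<nu>' \<tau>' b" "R a b"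
          using T[OF ns(2)] by blast
        have "waccepts A (map Inl ns) (Wt b)"
          unfolding A_def
          by (rule automatonA_accepts_path_I[OF k(1) nodes(1)[OF ns(2)]
                proofA[OF endA[OF k(1)] nodes(3)[OF k(1)]]])
        then show ?thesis using k ns by blast
      next
        case BotC
        then obtain ns \<nu> \<tau> where ns: "w = map Inl ns @ [Inr (equated S P \<nu> \<tau>, \<tau>)]"
            "traced P (delta2 S P) \<nu>0 \<tau>C ns \<nu> \<tau> a" "\<nu> \<in> Nodes P" "axiomatic P \<nu>"
            "\<tau> \<in> TVC_node S P \<nu>" "\<not> ground S P \<nu> \<tau>" "\<not> Excludes S (node_instance P \<nu>) \<tau>"
          using q by (auto simp: B_def automatonB_BotC)
        \<comment> \<open>As \<open>\<tau>\<close> is not ground, only the second alternative of the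
          ordering remains, and it forces \<open>k = length ns\<close>.\<close>
        then obtain \<nu>' \<tau>' b where b: "traced P (delta1 S P) \<nu>0 \<tau>A ns \<nu>' \<tau>' b" "R a b"
            "equates S (Seq P \<nu>) \<tau>' \<tau>"
          using T[OF ns(2) axiomatic_imp_terminal[OF ns(4)]] by auto
        \<comment> \<open>Both traces follow all of \<open>ns\<close> and so end at its last
          node.\<close>
        have "\<nu>' = \<nu>" using nodes(4)[OF b(1)] nodes(4)[OF ns(2)] by simp
        moreover have "\<tau>' \<in> equated S P \<nu> \<tau>"
          using b(3) by (auto simp: equated_def equates_def TVA_node_def)
        ultimately show ?thesis
          using b ns by (auto simp: A_def automatonA_accepts_equated_iff)
      next
        case InitC
        then show ?thesis using q by (simp add: B_def automatonB_def)
      qed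
    qed
    moreover have "grounded_automaton S P B"
      unfolding grounded_automaton_def
    proof (intro allI impI, elim conjE)
      fix \<nu> \<tau> assume f: "PairC \<nu> \<tau> \<in> wfinal B" and "wreachable B (PairC \<nu> \<tau>)"
      then obtain ns a where "traced P (delta2 S P) \<nu>0 \<tau>C ns \<nu> \<tau> a"
        by (auto simp: wreachable_iff_wreaches B_def automatonB_PairC)
      then show "ground S P \<nu> \<tau>"
        using T[of ns \<nu> \<tau> a] f by (auto simp: B_def automatonB_final_PairC)
    qed
    ultimately show "waccepts_dominated R (alphabet S P) B A \<and> grounded_automaton S P B" ..
  next
    assume D: "waccepts_dominated R (alphabet S P) B A \<and> grounded_automaton S P B"
    show "tv_order R S P \<nu>0 \<tau>C \<tau>A"
      unfolding iff
    proof (intro allI impI, elim conjE)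
      fix ns \<nu> \<tau> a
      assume tr: "traced P (delta2 S P) \<nu>0 \<tau>C ns \<nu> \<tau> a" and t: "terminal S P \<nu> \<tau>"
        and e: "\<not> Excludes S (node_instance P \<nu>) \<tau>"
      note n = nodes[OF tr] and c = endC[OF tr]
      show "\<exists>k \<nu>' \<tau>' b. k \<le> length ns \<and>
          traced P (delta1 S P) \<nu>0 \<tau>A (take k ns) \<nu>' \<tau>' b \<and> R a b \<and>
          (ground S P \<nu> \<tau> \<or> axiomatic P \<nu> \<and> k = length ns \<and> equates S (Seq P \<nu>) \<tau>' \<tau>)"
      \<comment> \<open>This separates the traces accepted through the extra letter in
        \<open>BotC\<close> from those whose state \<open>PairC \<nu> \<tau>\<close> is itself
        final.\<close>
      proof (cases "axiomatic P \<nu> \<and> \<not> ground S P \<nu> \<tau>")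
        case True
        let ?w = "map Inl ns @ [Inr (equated S P \<nu> \<tau>, \<tau>)] :: ('n, 'ta, 'tc) letter list"
        have "wreaches B ?w BotC (Wt a)"
          using tr n c e True by (auto simp: B_def automatonB_BotC)
        moreover have "BotC \<in> wfinal B" by (simp add: B_def automatonB_def)
        ultimately have "waccepts B ?w (Wt a)" by (auto simp: waccepts_def)
        moreover have "?w \<in> lists (alphabet S P)"
          using wordn[OF n(2)] proofA[OF _ n(3)] proofC[OF c n(3)]
          by (auto simp: alphabet_def equated_def)
        ultimately obtain b where b: "waccepts A ?w (Wt b)" "R a b"
          using D unfolding waccepts_dominated_def by blast
        then obtain \<nu>' \<tau>' where b': "traced P (delta1 S P) \<nu>0 \<tau>A ns \<nu>' \<tau>' b"
            "\<tau>' \<in> equated S P \<nu>' \<tau>"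
          by (auto simp: A_def automatonA_accepts_equated_iff)
        \<comment> \<open>The last letter alone need not determine the node, since two nodes may
          have the same set \<open>equated\<close>; the common word \<open>ns\<close> does.\<close>
        have "\<nu>' = \<nu>" using nodes(4)[OF b'(1)] n(4) by simp
        then show ?thesis
          using b b' True by (intro exI[of _ "length ns"]) (auto simp: equated_def)
      next
        case False
        let ?w = "map Inl ns :: ('n, 'ta, 'tc) letter list"
        have f: "PairC \<nu> \<tau> \<in> wfinal B"
          using False t e n proofC[OF c n(3)] by (auto simp: B_def automatonB_final_PairC)
        have r: "wreaches B ?w (PairC \<nu> \<tau>) (Wt a)"
          using tr by (auto simp: B_def automatonB_PairC)
        \<comment> \<open>For a node that is not axiomatic, this is where groundedness of the
          automaton enters.\<close>
        have g: "ground S P \<nu> \<tau>"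
          using D f r unfolding grounded_automaton_def wreachable_iff_wreaches by blast
        have "waccepts B ?w (Wt a)"
          using f r unfolding waccepts_def by blast
        then obtain b where b: "waccepts A ?w (Wt b)" "R a b"
          using D wordn[OF n(2)] unfolding waccepts_dominated_def by blast
        \<comment> \<open>Since \<open>\<tau>\<close> is ground, a left-hand trace along any prefix
          of \<open>ns\<close> suffices.\<close>
        show ?thesis
          using automatonA_accepts_path_D[OF b(1)[unfolded A_def]] b(2) g by blast
      qed
    qed
  qed
qed

theorem mainTheorem4:
  fixes S :: "('ant, 'con, 'r, 'm, 'ta, 'tc, 'o :: ordinal) system"
    and P :: "('n, 'ant, 'con, 'r) preproof"
    and \<nu> :: 'n and \<tau>A :: 'ta and \<tau>C :: 'tc
  assumes "entailment_system S"
    and "cyclic_proof S P"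
    and "\<nu> \<in> Nodes P"
    and "\<tau>A \<in> TVA_node S P \<nu>"
    and "\<tau>C \<in> TVC_node S P \<nu>"
  shows
    "(tv_less S P \<nu> \<tau>C \<tau>A \<longleftrightarrow>
        wlang_less (alphabet S P) (wlang (automatonB S P \<nu> \<tau>A \<tau>C)) (wlang (automatonA S P \<nu> \<tau>A \<tau>C)) \<and>
        grounded_automaton S P (automatonB S P \<nu> \<tau>A \<tau>C)) \<and>
     (tv_le S P \<nu> \<tau>C \<tau>A \<longleftrightarrow>
        wlang_le (alphabet S P) (wlang (automatonB S P \<nu> \<tau>A \<tau>C)) (wlang (automatonA S P \<nu> \<tau>A \<tau>C)) \<and>
        grounded_automaton S P (automatonB S P \<nu> \<tau>A \<tau>C))"
proof -
  have P: "cyclic_preproof S P" using assms(2) by (simp add: cyclic_proof_def)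
  have finP: "finite (Nodes P)" using P by (simp add: cyclic_preproof_def)
  have finT: "finite (TVA_proof S P)" "finite (TVC_proof S P)"
    using assms(1) finP
    by (auto simp: entailment_system_def TVA_proof_def TVC_proof_def TVA_node_def TVC_node_def)
  note edge = cyclic_preproof_edge[OF P]
  have proofA: "\<tau> \<in> TVA_proof S P" if "\<tau> \<in> TVA_node S P \<mu>" "\<mu> \<in> Nodes P" for \<tau> \<mu>
    using that by (auto simp: TVA_proof_def)
  have proofC: "\<tau> \<in> TVC_proof S P" if "\<tau> \<in> TVC_node S P \<mu>" "\<mu> \<in> Nodes P" for \<tau> \<mu>
    using that by (auto simp: TVC_proof_def)
  \<comment> \<open>Finiteness of both sets of runs is what turns the language values into
    maxima.\<close>
  have finA: "finite (wruns (automatonA S P \<nu> \<tau>A \<tau>C) w)" for w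
    using finP finT(1) assms(3) proofA[OF assms(4,3)] edge
    by (rule finite_wruns_automatonA) (blast intro: proofA delta1_target[OF assms(1) P] edge)+
  have finB: "finite (wruns (automatonB S P \<nu> \<tau>A \<tau>C) w)" for w
    using finP finT(2) assms(3) proofC[OF assms(5,3)] edge
    by (rule finite_wruns_automatonB) (blast intro: proofC delta2_target[OF assms(1) P] edge)+
  \<comment> \<open>The two claims are the instances \<open><\<close> and \<open>\<le>\<close> of
    \<open>R\<close>.\<close>
  show ?thesis
    unfolding wlang_less_iff[OF finA finB] wlang_le_iff[OF finA finB] tv_less_def tv_le_def
    using tv_order_iff_waccepts_dominated[OF assms(1) P assms(3-5)] by blast
qed

end
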